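(* Let $(\Omega,\mu)$ be a probability space and $X$ a Banach space. Suppose that $X^{*}$ is Gâteaux differentiable. Then $L^{p}(\Omega,X)^{*}$ is Gâteaux differentiable for every $1<p<+\infty$.
   Context: Banach spaces may be real or complex. $Y^{*}$ denotes the dual of a Banach space $Y$ with its dual norm. $L^{p}(\Omega,X)$ is the usual Bochner space of ($\mu$-a.e. classes of) strongly measurable functions $f:\Omega\to X$ with $\|f\|=\left(\int_\Omega\|f(\omega)\|_X^{p}\,d\mu(\omega)\right)^{1/p}<+\infty$. Definition (Gâteaux differentiable): a Banach space $(Y,\|\cdot\|)$ is Gâteaux differentiable if for every $a\in Y\setminus\{0\}$ and every $h\in Y$ the limit $\displaystyle\lim_{\mathbb{R}\ni t\to 0}\frac{\|a+th\|-\|a\|}{t}$ exists. *)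

theory Defs
  imports "HOL-Probability.Probability"
begin

text \<open>Normed spaces over the scalar field \<open>'k\<close> (used with \<open>'k = real\<close> and \<open>'k = complex\<close>).
  Bochner spaces depend on a measure and so are not types; hence the explicit carrier.\<close>

record ('k, 'v) nspace =
  vcarrier :: "'v set"
  vzero :: 'v
  vadd :: "'v \<Rightarrow> 'v \<Rightarrow> 'v"
  vscale :: "'k \<Rightarrow> 'v \<Rightarrow> 'v"
  vnorm :: "'v \<Rightarrow> real"

text \<open>The limit is over real \<open>t\<close>, also when the scalars are complex.\<close>

definition gateaux_differentiable :: "('k::real_normed_field, 'v) nspace \<Rightarrow> bool" where
  "gateaux_differentiable Y \<longleftrightarrow>
     (\<forall>a\<in>vcarrier Y - {vzero Y}. \<forall>h\<in>vcarrier Y.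
        \<exists>l. ((\<lambda>t::real. (vnorm Y (vadd Y a (vscale Y (of_real t) h)) - vnorm Y a) / t)
             \<longlongrightarrow> l) (at 0))"

text \<open>Functionals are made \<open>undefined\<close> outside the carrier, so that distinct elements of
  the dual are distinct functionals on the carrier.\<close>

definition bounded_functional :: "('k::real_normed_field, 'v) nspace \<Rightarrow> ('v \<Rightarrow> 'k) \<Rightarrow> bool" where
  "bounded_functional Y \<phi> \<longleftrightarrow>
     \<phi> \<in> extensional (vcarrier Y) \<and>
     (\<forall>x\<in>vcarrier Y. \<forall>y\<in>vcarrier Y. \<phi> (vadd Y x y) = \<phi> x + \<phi> y) \<and>
     (\<forall>c. \<forall>x\<in>vcarrier Y. \<phi> (vscale Y c x) = c * \<phi> x) \<and>
     (\<exists>C. \<forall>x\<in>vcarrier Y. norm (\<phi> x) \<le> C * vnorm Y x)"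

definition dual_space :: "('k::real_normed_field, 'v) nspace \<Rightarrow> ('k, 'v \<Rightarrow> 'k) nspace" where
  "dual_space Y =
     \<lparr> vcarrier = {\<phi>. bounded_functional Y \<phi>},
       vzero = (\<lambda>x\<in>vcarrier Y. 0),
       vadd = (\<lambda>\<phi> \<psi>. \<lambda>x\<in>vcarrier Y. \<phi> x + \<psi> x),
       vscale = (\<lambda>c \<phi>. \<lambda>x\<in>vcarrier Y. c * \<phi> x),
       vnorm = (\<lambda>\<phi>. SUP x\<in>{x \<in> vcarrier Y. vnorm Y x \<le> 1}. norm (\<phi> x)) \<rparr>"

text \<open>Multiplication by scalars in \<open>'k\<close> on a real normed type, compatible with its
  real structure and homogeneous for its norm. For \<open>'k = real\<close> only
  \<^const>\<open>scaleR\<close> qualifies; a complex Banach space is a type of class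
  \<^class>\<open>banach\<close> with such a multiplication for \<open>'k = complex\<close>.\<close>

definition normed_scaling :: "('k::real_normed_field \<Rightarrow> 'x::real_normed_vector \<Rightarrow> 'x) \<Rightarrow> bool" where
  "normed_scaling s \<longleftrightarrow> vector_space s \<and>
     (\<forall>r x. s (of_real r) x = r *\<^sub>R x) \<and> (\<forall>c x. norm (s c x) = norm c * norm x)"

definition type_space :: "('k \<Rightarrow> 'x::real_normed_vector \<Rightarrow> 'x) \<Rightarrow> ('k, 'x) nspace" where
  "type_space s = \<lparr> vcarrier = UNIV, vzero = 0, vadd = (+), vscale = s, vnorm = norm \<rparr>"

text \<open>The library's Bochner integral requires a second countable range. Since the range here
  need not be separable, strong measurability is defined as in the Bochner theory: pointwise
  limit of simple functions. Functions that are only almost everywhere such a limit would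
  yield the same classes.\<close>

definition strongly_measurable :: "'a measure \<Rightarrow> ('a \<Rightarrow> 'x::real_normed_vector) \<Rightarrow> bool" where
  "strongly_measurable M f \<longleftrightarrow>
     (\<exists>s. (\<forall>i. simple_function M (s i)) \<and> (\<forall>\<omega>\<in>space M. (\<lambda>i. s i \<omega>) \<longlonglongrightarrow> f \<omega>))"

definition Lp_fun :: "'a measure \<Rightarrow> real \<Rightarrow> ('a \<Rightarrow> 'x::real_normed_vector) set" where
  "Lp_fun M p = {f. strongly_measurable M f \<and> integrable M (\<lambda>\<omega>. norm (f \<omega>) powr p)}"

definition Lp_norm :: "'a measure \<Rightarrow> real \<Rightarrow> ('a \<Rightarrow> 'x::real_normed_vector) \<Rightarrow> real" where
  "Lp_norm M p f = (\<integral>\<omega>. norm (f \<omega>) powr p \<partial>M) powr (1 / p)"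

definition Lp_eq :: "'a measure \<Rightarrow> real \<Rightarrow> (('a \<Rightarrow> 'x::real_normed_vector) \<times> ('a \<Rightarrow> 'x)) set" where
  "Lp_eq M p = {(f, g). f \<in> Lp_fun M p \<and> g \<in> Lp_fun M p \<and> (AE \<omega> in M. f \<omega> = g \<omega>)}"

definition Lp_space ::
  "('k \<Rightarrow> 'x::real_normed_vector \<Rightarrow> 'x) \<Rightarrow> 'a measure \<Rightarrow> real \<Rightarrow> ('k, ('a \<Rightarrow> 'x) set) nspace" where
  "Lp_space s M p =
     \<lparr> vcarrier = Lp_fun M p // Lp_eq M p,
       vzero = Lp_eq M p `` {\<lambda>\<omega>. 0},
       vadd = (\<lambda>A B. \<Union>f\<in>A. \<Union>g\<in>B. Lp_eq M p `` {\<lambda>\<omega>. f \<omega> + g \<omega>}),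
       vscale = (\<lambda>c A. \<Union>f\<in>A. Lp_eq M p `` {\<lambda>\<omega>. s c (f \<omega>)}),
       vnorm = (\<lambda>A. the_elem (Lp_norm M p ` A)) \<rparr>"

lemma normed_scaling_scaleR: "normed_scaling (scaleR :: real \<Rightarrow> 'x::real_normed_vector \<Rightarrow> 'x)"
  unfolding normed_scaling_def by (simp add: vector_space_def scaleR_add_left scaleR_add_right)

lemma strongly_measurable_norm:
  assumes "strongly_measurable M f"
  shows "(\<lambda>\<omega>. norm (f \<omega>)) \<in> borel_measurable M"
proof -
  obtain s where s: "\<And>i. simple_function M (s i)" "\<And>\<omega>. \<omega> \<in> space M \<Longrightarrow> (\<lambda>i. s i \<omega>) \<longlonglongrightarrow> f \<omega>"
    using assms unfolding strongly_measurable_def by metis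
  have "simple_function M (\<lambda>\<omega>. norm (s i \<omega>))" for i
    using simple_function_compose[OF s(1), of norm] by (simp add: comp_def)
  then have meas: "(\<lambda>\<omega>. norm (s i \<omega>)) \<in> borel_measurable M" for i
    by (rule borel_measurable_simple_function)
  show ?thesis
  proof (rule borel_measurable_LIMSEQ_real)
    show "(\<lambda>i. norm (s i \<omega>)) \<longlonglongrightarrow> norm (f \<omega>)" if "\<omega> \<in> space M" for \<omega>
      by (rule tendsto_norm[OF s(2)[OF that]])
  qed (rule meas)
qed

lemma strongly_measurable_add:
  assumes "strongly_measurable M f" "strongly_measurable M g"
  shows "strongly_measurable M (\<lambda>\<omega>. f \<omega> + g \<omega>)"
proof -
  obtain s t where "\<And>i. simple_function M (s i)" "\<And>\<omega>. \<omega> \<in> space M \<Longrightarrow> (\<lambda>i. s i \<omega>) \<longlonglongrightarrow> f \<omega>"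
    "\<And>i. simple_function M (t i)" "\<And>\<omega>. \<omega> \<in> space M \<Longrightarrow> (\<lambda>i. t i \<omega>) \<longlonglongrightarrow> g \<omega>"
    using assms unfolding strongly_measurable_def by metis
  then show ?thesis unfolding strongly_measurable_def
    by (intro exI[of _ "\<lambda>i \<omega>. s i \<omega> + t i \<omega>"]) (simp add: tendsto_add simple_function_compose2[where h="(+)"])
qed

lemma strongly_measurable_scale:
  assumes "normed_scaling s" "strongly_measurable M f"
  shows "strongly_measurable M (\<lambda>\<omega>. s c (f \<omega>))"
proof -
  obtain u where u: "\<And>i. simple_function M (u i)" "\<And>\<omega>. \<omega> \<in> space M \<Longrightarrow> (\<lambda>i. u i \<omega>) \<longlonglongrightarrow> f \<omega>"
    using assms unfolding strongly_measurable_def by metis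
  have vs: "vector_space s" and s: "\<And>r x. s (of_real r) x = r *\<^sub>R x" "\<And>c x. norm (s c x) = norm c * norm x"
    using assms unfolding normed_scaling_def by auto
  have "bounded_linear (s c)"
  proof
    show "s c (x + y) = s c x + s c y" for x y
      using vs by (simp add: vector_space_def)
    show "s c (r *\<^sub>R x) = r *\<^sub>R s c x" for r x
      using vs s(1)[symmetric] by (simp add: vector_space_def mult.commute)
    show "\<exists>K. \<forall>x. norm (s c x) \<le> norm x * K"
      by (rule exI[of _ "norm c"]) (simp add: s mult.commute)
  qed
  moreover have "simple_function M (\<lambda>\<omega>. s c (u i \<omega>))" for i
    using simple_function_compose[OF u(1), of "s c"] by (simp add: comp_def)
  ultimately show ?thesis unfolding strongly_measurable_def
    by (intro exI[of _ "\<lambda>i \<omega>. s c (u i \<omega>)"]) (simp add: bounded_linear.tendsto[of "s c"] u(2))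
qed

lemma Lp_fun_zero: "(\<lambda>\<omega>. 0) \<in> Lp_fun M p"
proof -
  have "strongly_measurable M (\<lambda>\<omega>. 0)"
    unfolding strongly_measurable_def by (rule exI[of _ "\<lambda>i \<omega>. 0"]) simp
  then show ?thesis by (simp add: Lp_fun_def)
qed

lemma Lp_fun_add:
  assumes "p \<ge> 0" "f \<in> Lp_fun M p" "g \<in> Lp_fun M p"
  shows "(\<lambda>\<omega>. f \<omega> + g \<omega>) \<in> Lp_fun M p"
proof -
  have sm: "strongly_measurable M (\<lambda>\<omega>. f \<omega> + g \<omega>)"
    using assms by (auto simp: Lp_fun_def intro: strongly_measurable_add)
  have le: "norm (f \<omega> + g \<omega>) powr p \<le> 2 powr p * (norm (f \<omega>) powr p + norm (g \<omega>) powr p)" for \<omega>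
  proof -
    let ?m = "max (norm (f \<omega>)) (norm (g \<omega>))"
    have "norm (f \<omega> + g \<omega>) \<le> 2 * ?m"
      using norm_triangle_ineq[of "f \<omega>" "g \<omega>"] by linarith
    then have "norm (f \<omega> + g \<omega>) powr p \<le> (2 * ?m) powr p"
      using assms by (intro powr_mono2) auto
    also have "\<dots> = 2 powr p * ?m powr p"
      by (subst powr_mult) auto
    also have "\<dots> \<le> 2 powr p * (norm (f \<omega>) powr p + norm (g \<omega>) powr p)"
      by (intro mult_left_mono) (auto simp: max_def)
    finally show ?thesis .
  qed
  have "integrable M (\<lambda>\<omega>. 2 powr p * (norm (f \<omega>) powr p + norm (g \<omega>) powr p))"
    using assms by (auto simp: Lp_fun_def)
  then have "integrable M (\<lambda>\<omega>. norm (f \<omega> + g \<omega>) powr p)"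
  proof (rule Bochner_Integration.integrable_bound)
    show "(\<lambda>\<omega>. norm (f \<omega> + g \<omega>) powr p) \<in> borel_measurable M"
      using strongly_measurable_norm[OF sm] by measurable
    show "AE \<omega> in M. norm (norm (f \<omega> + g \<omega>) powr p)
        \<le> norm (2 powr p * (norm (f \<omega>) powr p + norm (g \<omega>) powr p))"
    proof (rule AE_I2)
      show "norm (norm (f \<omega> + g \<omega>) powr p)
          \<le> norm (2 powr p * (norm (f \<omega>) powr p + norm (g \<omega>) powr p))" for \<omega>
        using le[of \<omega>] by simp
    qed
  qed
  with sm show ?thesis by (simp add: Lp_fun_def)
qed

lemma Lp_fun_scale:
  assumes "normed_scaling s" "f \<in> Lp_fun M p"
  shows "(\<lambda>\<omega>. s c (f \<omega>)) \<in> Lp_fun M p"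
proof -
  have "norm (s c x) powr p = norm c powr p * norm x powr p" for x
    using assms(1) by (simp add: normed_scaling_def powr_mult)
  then show ?thesis
    using assms by (simp add: Lp_fun_def strongly_measurable_scale)
qed

lemma equiv_Lp_eq: "equiv (Lp_fun M p) (Lp_eq M p)"
proof (rule equivI)
  show "Lp_eq M p \<subseteq> Lp_fun M p \<times> Lp_fun M p" by (auto simp: Lp_eq_def)
  show "refl_on (Lp_fun M p) (Lp_eq M p)" by (auto simp: refl_on_def Lp_eq_def)
  show "sym (Lp_eq M p)" by (simp add: sym_def Lp_eq_def eq_commute)
  show "trans (Lp_eq M p)" unfolding trans_def Lp_eq_def by (auto elim: eventually_elim2)
qed

lemma Lp_space_add_class:
  fixes f g :: "'a \<Rightarrow> 'x::real_normed_vector"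
  assumes "p \<ge> 0" "f \<in> Lp_fun M p" "g \<in> Lp_fun M p"
  shows "vadd (Lp_space s M p) (Lp_eq M p `` {f}) (Lp_eq M p `` {g}) = Lp_eq M p `` {\<lambda>\<omega>. f \<omega> + g \<omega>}"
proof -
  have "congruent2 (Lp_eq M p) (Lp_eq M p) (\<lambda>(f::'a \<Rightarrow> 'x) g. Lp_eq M p `` {\<lambda>\<omega>. f \<omega> + g \<omega>})"
    unfolding congruent2_def
  proof clarify
    fix f1 f2 g1 g2 :: "'a \<Rightarrow> 'x" assume *: "(f1, f2) \<in> Lp_eq M p" "(g1, g2) \<in> Lp_eq M p"
    then have "AE \<omega> in M. f1 \<omega> + g1 \<omega> = f2 \<omega> + g2 \<omega>"
      unfolding Lp_eq_def by (auto elim: eventually_elim2)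
    with * have "(\<lambda>\<omega>. f1 \<omega> + g1 \<omega>, \<lambda>\<omega>. f2 \<omega> + g2 \<omega>) \<in> Lp_eq M p"
      using assms(1) by (simp add: Lp_eq_def Lp_fun_add)
    then show "Lp_eq M p `` {\<lambda>\<omega>. f1 \<omega> + g1 \<omega>} = Lp_eq M p `` {\<lambda>\<omega>. f2 \<omega> + g2 \<omega>}"
      by (rule equiv_class_eq[OF equiv_Lp_eq])
  qed
  from UN_equiv_class2[OF equiv_Lp_eq equiv_Lp_eq this assms(2,3)] show ?thesis
    by (simp add: Lp_space_def)
qed

lemma Lp_space_scale_class:
  fixes f :: "'a \<Rightarrow> 'x::real_normed_vector"
  assumes "normed_scaling s" "f \<in> Lp_fun M p"
  shows "vscale (Lp_space s M p) c (Lp_eq M p `` {f}) = Lp_eq M p `` {\<lambda>\<omega>. s c (f \<omega>)}"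
proof -
  have "congruent (Lp_eq M p) (\<lambda>f. Lp_eq M p `` {\<lambda>\<omega>. s c (f \<omega>)})"
  proof (rule congruentI)
    fix f1 f2 :: "'a \<Rightarrow> 'x" assume *: "(f1, f2) \<in> Lp_eq M p"
    then have "AE \<omega> in M. s c (f1 \<omega>) = s c (f2 \<omega>)"
      unfolding Lp_eq_def by (auto elim: eventually_mono)
    with * have "(\<lambda>\<omega>. s c (f1 \<omega>), \<lambda>\<omega>. s c (f2 \<omega>)) \<in> Lp_eq M p"
      using assms(1) by (simp add: Lp_eq_def Lp_fun_scale)
    then show "Lp_eq M p `` {\<lambda>\<omega>. s c (f1 \<omega>)} = Lp_eq M p `` {\<lambda>\<omega>. s c (f2 \<omega>)}"
      by (rule equiv_class_eq[OF equiv_Lp_eq])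
  qed
  from UN_equiv_class[OF equiv_Lp_eq this assms(2)] show ?thesis
    by (simp add: Lp_space_def)
qed

lemma Lp_space_norm_class:
  assumes "f \<in> Lp_fun M p"
  shows "vnorm (Lp_space s M p) (Lp_eq M p `` {f}) = Lp_norm M p f"
proof -
  have "Lp_norm M p g = Lp_norm M p f" if "(f, g) \<in> Lp_eq M p" for g
  proof -
    have int: "integrable M (\<lambda>\<omega>. norm (f \<omega>) powr p)" "integrable M (\<lambda>\<omega>. norm (g \<omega>) powr p)"
      and ae: "AE \<omega> in M. f \<omega> = g \<omega>"
      using that by (simp_all add: Lp_eq_def Lp_fun_def)
    have "AE \<omega> in M. norm (g \<omega>) powr p = norm (f \<omega>) powr p"
      using ae by eventually_elim simp
    then have "(\<integral>\<omega>. norm (g \<omega>) powr p \<partial>M) = (\<integral>\<omega>. norm (f \<omega>) powr p \<partial>M)"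
      by (rule integral_cong_AE[OF borel_measurable_integrable[OF int(2)]
            borel_measurable_integrable[OF int(1)]])
    then show ?thesis by (simp only: Lp_norm_def)
  qed
  moreover have "(f, f) \<in> Lp_eq M p" using assms by (simp add: Lp_eq_def)
  ultimately have "Lp_norm M p ` (Lp_eq M p `` {f}) = {Lp_norm M p f}" by blast
  then show ?thesis by (simp add: Lp_space_def)
qed

end

(*  Write p, q for conjugate exponents. The dual of L^p(X) need not be L^q(X* ), but
    differentiability of a dual norm at F in direction G is a statement about
    ||F + tG|| + ||F - tG|| - 2 ||F|| = o(t), hence about one sequence t_n -> 0 and countably many
    near-maximisers, approximated by simple functions with values in one countable subgroup S of X.
    On S the functionals F, G have scalar densities g_s, h_s by Radon-Nikodym, which after correction on
    a null set are additive and bounded in s at every point w. With n_t(w) the norm of g(w) + t h(w)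
    on S, the integral of n_t^q is at most ||F + tG||^q, and Young's inequality bounds ||F + tG||
    in terms of that integral. So it suffices to differentiate the integral at t = 0: dominated
    convergence applies because the second difference quotients of the convex function t |-> n_t^q
    decrease to their limit, and pointwise one extends g(w), h(w) to X by Hahn-Banach, preserving
    norms, and uses the differentiability of the norm of X*.
    Complex scalars reduce to real ones since a functional and its real part have the same norm. *)

theory Submission
  imports Defs
begin

text \<open>A Radon-Nikodym density exists for each vector separately and up to its own null set, so
  relations among uncountably many densities cannot be arranged at a single point. Hence t_n is
  fixed before S. Closure under differences is the only relation imposed on the densities; real
  linearity returns through Hahn-Banach over the integers. Densities of F + tG have the form g + t
  h, so one null set serves all t. Smoothness is transferred twice by the same sandwich: if N is
  convex, N <= M away from 0 and M(0) <= N(0), then the second differences of N at 0 are nonnegative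
  and at most those of M. Pointwise, M is the norm of the extension of g(w) + t h(w), and M(0) <=
  N(0) because the extension of g(w) keeps its norm. Globally, with R = ||F||, M is a I(t) + R/p,
  where I(t) is the integral of n_t^q and a = R^(1-q)/q; it bounds ||F + tG|| only along the
  sequence and up to o(t_n), and M(0) <= R because I(0) <= R^q. The power q > 1 also takes care of
  the points with g(w) = 0, where the norm itself need not be differentiable.\<close>

section \<open>Second differences of convex functions\<close>

lemma second_difference_tendsto_0:
  fixes N :: "real \<Rightarrow> real"
  assumes "((\<lambda>t. (N t - N 0) / t) \<longlongrightarrow> l) (at 0)"
  shows "((\<lambda>t. (N t + N (-t) - 2 * N 0) / t) \<longlongrightarrow> 0) (at_right 0)"
proof -
  have "((\<lambda>t. (N (-t) - N 0) / (-t)) \<longlongrightarrow> l) (at 0)"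
  proof -
    have "filterlim uminus (at 0) (at (0::real))"
      unfolding filterlim_at by (auto intro!: tendsto_eq_intros simp: eventually_at_filter)
    from filterlim_compose[OF assms this] show ?thesis .
  qed
  then have "((\<lambda>t. (N t - N 0) / t - (N (-t) - N 0) / (-t)) \<longlongrightarrow> l - l) (at 0)"
    by (intro tendsto_diff assms)
  moreover have "(N t - N 0) / t - (N (-t) - N 0) / (-t) = (N t + N (-t) - 2 * N 0) / t" for t
    by (cases "t = 0") (simp_all add: field_simps)
  ultimately show ?thesis
    by (auto intro: tendsto_within_subset)
qed

lemma convex_on_second_difference_nonneg:
  fixes N :: "real \<Rightarrow> real"
  assumes "convex_on UNIV N"
  shows "0 \<le> N t + N (-t) - 2 * N 0"
  using convex_onD[OF assms, of "1/2" t "-t"] by simp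

text \<open>Convexity compares the chords from 0 to \<open>t\<close> and \<open>-t\<close> with
  those to 1 and -1. The bound is independent of \<open>t\<close> and so gives a dominating function
  under the integral.\<close>

lemma convex_on_second_difference_le:
  fixes N :: "real \<Rightarrow> real"
  assumes "convex_on UNIV N" "0 < t" "t \<le> 1"
  shows "(N t + N (-t) - 2 * N 0) / t \<le> N 1 + N (-1) - 2 * N 0"
proof -
  have "N t \<le> (1 - t) * N 0 + t * N 1" "N (-t) \<le> (1 - t) * N 0 + t * N (-1)"
    using convex_onD[OF assms(1), of t 0 1] convex_onD[OF assms(1), of t 0 "-1"] assms(2,3)
    by simp_all
  then show ?thesis using assms(2) by (simp add: field_simps)
qed

text \<open>Left quotients never exceed right quotients, so \<open>l\<close> separates them; the gap
  between \<open>Q t\<close> and \<open>Q (-t)\<close> is exactly the second difference quotient,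
  and both are squeezed onto \<open>l\<close>. This turns symmetric information back into a
  derivative.\<close>

lemma convex_on_differentiable_at_0:
  fixes N :: "real \<Rightarrow> real"
  assumes conv: "convex_on UNIV N"
    and lim: "((\<lambda>t. (N t + N (-t) - 2 * N 0) / t) \<longlongrightarrow> 0) (at_right 0)"
  shows "\<exists>l. ((\<lambda>t. (N t - N 0) / t) \<longlongrightarrow> l) (at 0)"
proof -
  define Q where "Q t = (N t - N 0) / t" for t
  define l where "l = Inf (Q ` {0<..})"
  have QQ: "Q (-s) \<le> Q t" if "s > 0" "t > 0" for s t
  proof -
    \<comment> \<open>0 is the convex combination of \<open>t\<close> and \<open>-s\<close> with
      weights \<open>s/(s+t)\<close> and \<open>t/(s+t)\<close>.\<close>
    have "(1 - t/(s+t)) *\<^sub>R t + (t/(s+t)) *\<^sub>R (-s) = 0"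
      using that by (simp add: field_simps)
    with convex_onD[OF conv, of "t/(s+t)" t "-s"] that
    have "N 0 \<le> (1 - t/(s+t)) * N t + (t/(s+t)) * N (-s)" by simp
    also have "1 - t/(s+t) = s/(s+t)" using that by (simp add: field_simps)
    also have "s/(s+t) * N t + t/(s+t) * N (-s) = (s * N t + t * N (-s)) / (s + t)"
      by (simp add: add_divide_distrib)
    finally have "(s + t) * N 0 \<le> s * N t + t * N (-s)"
      using that by (simp add: field_simps)
    then show ?thesis using that by (simp add: Q_def field_simps)
  qed
  have bdd: "bdd_below (Q ` {0<..})"
    by (rule bdd_belowI2[of _ "Q (-1)"]) (simp add: QQ)
  have l: "Q (-t) \<le> l" "l \<le> Q t" if "t > 0" for t
    unfolding l_def using that QQ by (auto intro!: cINF_greatest cINF_lower[OF bdd])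
  have bound: "\<bar>Q t - l\<bar> \<le> (N \<bar>t\<bar> + N (- \<bar>t\<bar>) - 2 * N 0) / \<bar>t\<bar>" if "t \<noteq> 0" for t
  proof -
    have "(N \<bar>t\<bar> + N (- \<bar>t\<bar>) - 2 * N 0) / \<bar>t\<bar> = Q \<bar>t\<bar> - Q (- \<bar>t\<bar>)"
      using that by (simp add: Q_def add_divide_distrib diff_divide_distrib)
    then show ?thesis using l[of "\<bar>t\<bar>"] that by (cases "t > 0") auto
  qed
  have "filterlim (\<lambda>t::real. \<bar>t\<bar>) (at_right 0) (at 0)"
    unfolding filterlim_at by (auto intro!: tendsto_eq_intros simp: eventually_at_filter)
  from filterlim_compose[OF lim this]
  have "((\<lambda>t. Q t - l) \<longlongrightarrow> 0) (at 0)"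
    by (rule Lim_null_comparison[rotated]) (simp add: eventually_at_filter bound)
  then have "(Q \<longlongrightarrow> l) (at 0)" by (rule LIM_zero_cancel)
  then show ?thesis unfolding Q_def by blast
qed

lemma convex_on_powr_atLeast_0:
  fixes q :: real
  assumes "1 \<le> q"
  shows "convex_on {0..} (\<lambda>x. x powr q)"
proof (rule convex_onI)
  fix t x y :: real assume t: "0 < t" "t < 1" "x \<in> {0..}" "y \<in> {0..}"
  \<comment> \<open>With one endpoint equal to 0, convexity reduces to
    \<open>t powr q \<le> t\<close> on the unit interval.\<close>
  have *: "(t * y) powr q \<le> t * y powr q" if "0 \<le> y" "0 < t" "t < 1" for t y :: real
  proof -
    have "t powr q \<le> t powr 1" using assms that by (intro powr_mono') auto
    then show ?thesis using that by (simp add: powr_mult mult_right_mono)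
  qed
  show "((1 - t) *\<^sub>R x + t *\<^sub>R y) powr q \<le> (1 - t) * x powr q + t * y powr q"
  proof (cases "x = 0 \<or> y = 0")
    case True
    then show ?thesis using *[of y t] *[of x "1 - t"] t by auto
  next
    case False
    then show ?thesis
      using convex_onD[OF powr_convex[OF assms], of t x y] t by auto
  qed
qed simp

text \<open>The norm of \<open>u + t v\<close> as a function of \<open>t\<close>. The index set is
  left open: it will be the indices of a sequence, the unit ball of X and the unit ball of the
  Bochner space.\<close>

lemma convex_on_SUP_abs:
  fixes u v :: "'b \<Rightarrow> real"
  assumes "B \<noteq> {}" "\<And>b. b \<in> B \<Longrightarrow> \<bar>u b\<bar> \<le> K" "\<And>b. b \<in> B \<Longrightarrow> \<bar>v b\<bar> \<le> L"
  shows "bdd_above ((\<lambda>b. \<bar>u b + t * v b\<bar>) ` B)"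
    and "convex_on UNIV (\<lambda>t. SUP b\<in>B. \<bar>u b + t * v b\<bar>)"
proof -
  show bdd: "bdd_above ((\<lambda>b. \<bar>u b + t * v b\<bar>) ` B)" for t
  proof (rule bdd_aboveI2)
    fix b assume "b \<in> B"
    then show "\<bar>u b + t * v b\<bar> \<le> K + \<bar>t\<bar> * L"
      using assms(2,3)[of b] mult_left_mono[of "\<bar>v b\<bar>" L "\<bar>t\<bar>"]
      by (simp flip: abs_mult)
  qed
  show "convex_on UNIV (\<lambda>t. SUP b\<in>B. \<bar>u b + t * v b\<bar>)"
  proof (rule convex_onI)
    fix r x y :: real assume r: "0 < r" "r < 1"
    show "(SUP b\<in>B. \<bar>u b + ((1 - r) *\<^sub>R x + r *\<^sub>R y) * v b\<bar>)
      \<le> (1 - r) * (SUP b\<in>B. \<bar>u b + x * v b\<bar>) + r * (SUP b\<in>B. \<bar>u b + y * v b\<bar>)"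
    proof (rule cSUP_least[OF assms(1)])
      fix b assume b: "b \<in> B"
      have "u b + ((1 - r) *\<^sub>R x + r *\<^sub>R y) * v b = (1 - r) * (u b + x * v b) + r * (u b + y * v b)"
        by (simp add: algebra_simps)
      also have "\<bar>\<dots>\<bar> \<le> (1 - r) * \<bar>u b + x * v b\<bar> + r * \<bar>u b + y * v b\<bar>"
        using r abs_triangle_ineq[of "(1 - r) * (u b + x * v b)" "r * (u b + y * v b)"]
        by (simp add: abs_mult)
      also have "\<dots> \<le> (1 - r) * (SUP b\<in>B. \<bar>u b + x * v b\<bar>) + r * (SUP b\<in>B. \<bar>u b + y * v b\<bar>)"
        using r by (intro add_mono mult_left_mono cSUP_upper[OF b bdd]) auto
      finally show "\<bar>u b + ((1 - r) *\<^sub>R x + r *\<^sub>R y) * v b\<bar> \<le> \<dots>" .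
    qed
  qed simp
qed

section \<open>Hahn--Banach for additive subgroups\<close>

text \<open>Additivity gives homogeneity for integers. For real \<open>r\<close>, the number
  \<open>n * r\<close> lies within 1 of an integer, so \<open>n\<close> times the error
  \<open>f (r *\<^sub>R x) - r * f x\<close> stays bounded as \<open>n\<close> grows, and the error
  is 0.\<close>

lemma bounded_linear_if_additive_bounded:
  fixes f :: "'x::real_normed_vector \<Rightarrow> real"
  assumes diff: "\<And>x y. f (x - y) = f x - f y" and bound: "\<And>x. \<bar>f x\<bar> \<le> B * norm x"
  shows "bounded_linear f"
proof -
  interpret additive f
  proof
    fix x y
    have "f 0 = 0" using diff[of 0 0] by simp
    then show "f (x + y) = f x + f y" using diff[of x "-y"] diff[of 0 y] by simp
  qed
  have nat: "f (real n *\<^sub>R x) = real n * f x" for n x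
    by (induction n) (simp_all add: scaleR_add_left add zero algebra_simps)
  have int: "f (of_int m *\<^sub>R x) = of_int m * f x" for m x
  proof (cases m rule: int_cases2)
    case (nonneg n)
    then show ?thesis using nat[of n x] by simp
  next
    case (nonpos n)
    then show ?thesis using nat[of n x] minus[of "real n *\<^sub>R x"] by simp
  qed
  have "f (r *\<^sub>R x) = r * f x" for r x
  proof (rule ccontr)
    assume ne: "f (r *\<^sub>R x) \<noteq> r * f x"
    define e where "e = f (r *\<^sub>R x) - r * f x"
    have "real n * \<bar>e\<bar> \<le> 2 * B * norm x" for n
    proof -
      define m where "m = \<lfloor>real n * r\<rfloor>"
      have *: "\<bar>real n * r - of_int m\<bar> \<le> 1" unfolding m_def by linarith
      have "f ((real n * r - of_int m) *\<^sub>R x) = f (real n *\<^sub>R (r *\<^sub>R x)) - f (of_int m *\<^sub>R x)"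
        by (simp only: scaleR_diff_left diff scaleR_scaleR)
      also have "\<dots> = real n * f (r *\<^sub>R x) - of_int m * f x" by (simp only: nat int)
      finally have "real n * e = f ((real n * r - of_int m) *\<^sub>R x) + (of_int m - real n * r) * f x"
        by (simp add: e_def algebra_simps)
      then have "\<bar>real n * e\<bar> \<le> \<bar>f ((real n * r - of_int m) *\<^sub>R x)\<bar> + \<bar>(of_int m - real n * r) * f x\<bar>"
        by (simp only: abs_triangle_ineq)
      then have "real n * \<bar>e\<bar> \<le> \<bar>f ((real n * r - of_int m) *\<^sub>R x)\<bar> + \<bar>real n * r - of_int m\<bar> * \<bar>f x\<bar>"
        by (simp add: abs_mult abs_minus_commute[of "of_int m"])
      also have "\<dots> \<le> B * (\<bar>real n * r - of_int m\<bar> * norm x) + \<bar>real n * r - of_int m\<bar> * (B * norm x)"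
        using bound[of "(real n * r - of_int m) *\<^sub>R x"] bound[of x] by (intro add_mono mult_left_mono) auto
      also have "\<dots> = \<bar>real n * r - of_int m\<bar> * (2 * B * norm x)" by (simp add: algebra_simps)
      also have "\<dots> \<le> 1 * (2 * B * norm x)"
        using * bound[of x] by (intro mult_right_mono) auto
      finally show ?thesis by simp
    qed
    moreover have "\<bar>e\<bar> > 0" using ne by (simp add: e_def)
    ultimately show False
      using reals_Archimedean3[of "\<bar>e\<bar>"] by (metis not_le)
  qed
  with bound show ?thesis
    by (intro bounded_linear_intro[where K = B]) (auto simp: add mult.commute)
qed

text \<open>Hahn--Banach over \<open>\<int>\<close>. The extensions are ordered as graphs: an additive subgroup of
  \<open>X \<times> \<real>\<close> on which the second component is at most \<open>B\<close> times the norm of the first is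
  automatically single-valued.\<close>

lemma hahn_banach_subgroup:
  fixes g :: "'x::real_normed_vector \<Rightarrow> real"
  assumes S: "0 \<in> S" "\<And>x y. x \<in> S \<Longrightarrow> y \<in> S \<Longrightarrow> x - y \<in> S"
    and g: "\<And>x y. x \<in> S \<Longrightarrow> y \<in> S \<Longrightarrow> g (x - y) = g x - g y"
    and bound: "\<And>x. x \<in> S \<Longrightarrow> \<bar>g x\<bar> \<le> B * norm x" and B: "0 \<le> B"
  obtains f where "bounded_linear f" "\<And>x. x \<in> S \<Longrightarrow> f x = g x" "\<And>x. \<bar>f x\<bar> \<le> B * norm x"
proof -
  define graphs where "graphs = {G :: ('x \<times> real) set. (\<lambda>x. (x, g x)) ` S \<subseteq> G \<and>
    (\<forall>a\<in>G. \<forall>b\<in>G. a - b \<in> G) \<and> (\<forall>a\<in>G. snd a \<le> B * norm (fst a))}"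
  have "(\<lambda>x. (x, g x)) ` S \<in> graphs"
    unfolding graphs_def
  proof (intro CollectI conjI ballI subset_refl; elim imageE)
    fix a b x y assume "a = (x, g x)" "x \<in> S" "b = (y, g y)" "y \<in> S"
    then have "a - b = (x - y, g (x - y))" "x - y \<in> S" using S(2) g by simp_all
    then show "a - b \<in> (\<lambda>x. (x, g x)) ` S" by blast
  next
    fix a x assume "a = (x, g x)" "x \<in> S"
    then show "snd a \<le> B * norm (fst a)" using bound[of x] by simp
  qed
  then have "graphs \<noteq> {}" by blast
  moreover have "\<Union>C \<in> graphs" if "C \<noteq> {}" "subset.chain graphs C" for C
  proof -
    have C: "\<And>G. G \<in> C \<Longrightarrow> G \<in> graphs" "\<And>G H. G \<in> C \<Longrightarrow> H \<in> C \<Longrightarrow> G \<subseteq> H \<or> H \<subseteq> G"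
      using that(2) by (auto simp: subset_chain_def)
    have closed: "a - b \<in> G" if "G \<in> C" "a \<in> G" "b \<in> G" for G a b
      using C(1)[OF that(1)] that(2,3) unfolding graphs_def by blast
    show ?thesis
      unfolding graphs_def
    proof (intro CollectI conjI ballI)
      obtain G where "G \<in> C" using \<open>C \<noteq> {}\<close> by blast
      then show "(\<lambda>x. (x, g x)) ` S \<subseteq> \<Union>C" using C(1)[of G] unfolding graphs_def by blast
    next
      fix a b assume "a \<in> \<Union>C" "b \<in> \<Union>C"
      then obtain G H where GH: "G \<in> C" "H \<in> C" "a \<in> G" "b \<in> H" by blast
      from C(2)[OF GH(1,2)] show "a - b \<in> \<Union>C"
      proof
        assume "G \<subseteq> H" then have "a - b \<in> H" using closed[OF GH(2)] GH by blast
        then show ?thesis using GH by blast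
      next
        assume "H \<subseteq> G" then have "a - b \<in> G" using closed[OF GH(1)] GH by blast
        then show ?thesis using GH by blast
      qed
    next
      fix a assume "a \<in> \<Union>C"
      then obtain G where "G \<in> C" "a \<in> G" by blast
      then show "snd a \<le> B * norm (fst a)" using C(1)[of G] unfolding graphs_def by blast
    qed
  qed
  ultimately obtain G where G: "G \<in> graphs" and max: "\<And>H. H \<in> graphs \<Longrightarrow> G \<subseteq> H \<Longrightarrow> H = G"
    using subset_Zorn_nonempty[of graphs] by blast
  have G_sub: "\<And>x. x \<in> S \<Longrightarrow> (x, g x) \<in> G" and G_diff: "\<And>a b. a \<in> G \<Longrightarrow> b \<in> G \<Longrightarrow> a - b \<in> G"
    and G_le: "\<And>x r. (x, r) \<in> G \<Longrightarrow> r \<le> B * norm x"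
    using G unfolding graphs_def by (blast, blast, fastforce)
  have G_0: "0 \<in> G" using G_diff[OF G_sub[OF S(1)] G_sub[OF S(1)]] by (simp add: zero_prod_def)
  have G_minus: "- a \<in> G" if "a \<in> G" for a using G_diff[OF G_0 that] by simp
  have G_add: "a + b \<in> G" if "a \<in> G" "b \<in> G" for a b using G_diff[OF that(1) G_minus[OF that(2)]] by simp
  have G_mult: "real n *\<^sub>R a \<in> G" if "a \<in> G" for a n
  proof (induction n)
    case (Suc n) then show ?case using G_add[OF that Suc] by (simp add: scaleR_add_left)
  qed (simp add: G_0)
  have total: "\<exists>r. (x, r) \<in> G" for x
  proof -
    \<comment> \<open>Upper bounds for the value \<open>c\<close> to be assigned to
      \<open>x\<close>, read off from \<open>r + n * c \<le> B * norm (y + n *\<^sub>R x)\<close>.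
      Elements of a subgroup cannot be divided by \<open>n\<close>, so all positive multiples of
      \<open>x\<close> are considered.\<close>
    define U where "U = {(B * norm (y + real n *\<^sub>R x) - r) / real n | y r n. n > 0 \<and> (y, r) \<in> G}"
    have cmp: "(r' - B * norm (y' - real k *\<^sub>R x)) / real k \<le> u"
      if yr: "(y', r') \<in> G" "k > 0" and "u \<in> U" for y' r' k u
    proof -
      from \<open>u \<in> U\<close> obtain y r n where u: "u = (B * norm (y + real n *\<^sub>R x) - r) / real n"
        "n > 0" "(y, r) \<in> G" unfolding U_def by blast
      \<comment> \<open>With the weights \<open>k\<close> and \<open>n\<close> the multiples of
        \<open>x\<close> cancel inside the norm.\<close>
      have "real k *\<^sub>R (y, r) + real n *\<^sub>R (y', r') \<in> G"
        using yr u by (intro G_add G_mult)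
      then have "real k * r + real n * r' \<le> B * norm (real k *\<^sub>R y + real n *\<^sub>R y')"
        using G_le by simp
      also have "real k *\<^sub>R y + real n *\<^sub>R y' = real k *\<^sub>R (y + real n *\<^sub>R x) + real n *\<^sub>R (y' - real k *\<^sub>R x)"
        by (simp add: algebra_simps)
      also have "B * norm \<dots> \<le> B * (real k * norm (y + real n *\<^sub>R x) + real n * norm (y' - real k *\<^sub>R x))"
        by (intro mult_left_mono B norm_triangle_le) simp
      finally show ?thesis using yr(2) u(2) unfolding u(1) by (simp add: field_simps)
    qed
    have "(B * norm (0 + real 1 *\<^sub>R x) - 0) / real 1 \<in> U"
      using G_0 unfolding U_def zero_prod_def by blast
    then have ne: "U \<noteq> {}" by blast
    have "bdd_below U" using cmp[OF G_0[unfolded zero_prod_def], of 1] by (intro bdd_belowI) auto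
    define c where "c = Inf U"
    have c1: "r + real n * c \<le> B * norm (y + real n *\<^sub>R x)" if "(y, r) \<in> G" "n > 0" for y r n
    proof -
      have "c \<le> (B * norm (y + real n *\<^sub>R x) - r) / real n"
        unfolding c_def using that by (intro cInf_lower \<open>bdd_below U\<close>) (auto simp: U_def)
      then show ?thesis using that by (simp add: field_simps)
    qed
    have c2: "r - real n * c \<le> B * norm (y - real n *\<^sub>R x)" if "(y, r) \<in> G" "n > 0" for y r n
    proof -
      have "(r - B * norm (y - real n *\<^sub>R x)) / real n \<le> c"
        unfolding c_def using that ne cmp by (intro cInf_greatest) auto
      then show ?thesis using that by (simp add: field_simps)
    qed
    \<comment> \<open>The subgroup generated by \<open>G\<close> and \<open>(x, c)\<close>;
      \<open>c1\<close> and \<open>c2\<close> are its norm bound for positive and negative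
      \<open>m\<close>.\<close>
    define H where "H = {a + of_int m *\<^sub>R (x, c) | a m. a \<in> G}"
    have H_I: "a + of_int m *\<^sub>R (x, c) \<in> H" if "a \<in> G" for a m
      using that unfolding H_def by blast
    have "H \<in> graphs"
      unfolding graphs_def
    proof (intro CollectI conjI ballI)
      show "(\<lambda>x. (x, g x)) ` S \<subseteq> H"
        using H_I[OF G_sub, of _ 0] by auto
    next
      fix a b assume "a \<in> H" "b \<in> H"
      then obtain a' m b' n where ab: "a = a' + of_int m *\<^sub>R (x, c)" "b = b' + of_int n *\<^sub>R (x, c)" "a' \<in> G" "b' \<in> G"
        unfolding H_def by blast
      have "a - b = (a' - b') + of_int (m - n) *\<^sub>R (x, c)"
        unfolding ab of_int_diff scaleR_diff_left by simp
      then show "a - b \<in> H" using H_I[OF G_diff[OF ab(3,4)]] by metis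
    next
      fix a assume "a \<in> H"
      then obtain y r m where a: "a = (y, r) + of_int m *\<^sub>R (x, c)" "(y, r) \<in> G"
        unfolding H_def by auto
      consider n where "m = int n" "n > 0" | n where "m = - int n" "n > 0" | "m = 0"
        by (metis int_cases3 of_nat_0_less_iff)
      then show "snd a \<le> B * norm (fst a)"
        by cases (use a c1 c2 G_le in \<open>auto\<close>)
    qed
    moreover have "G \<subseteq> H" using H_I[of _ 0] by auto
    ultimately have "H = G" by (rule max)
    moreover have "0 + of_int 1 *\<^sub>R (x, c) \<in> H" by (rule H_I[OF G_0])
    ultimately show ?thesis by auto
  qed
  then obtain f where f: "\<And>x. (x, f x) \<in> G" by metis
  have unique: "r = s" if "(x, r) \<in> G" "(x, s) \<in> G" for x r s
    using G_le[of 0 "r - s"] G_le[of 0 "s - r"] G_diff[OF that] G_diff[OF that(2,1)] by simp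
  have f_diff: "f (x - y) = f x - f y" for x y
    using unique[OF f, of "x - y"] G_diff[OF f[of x] f[of y]] by simp
  have f_bound: "\<bar>f x\<bar> \<le> B * norm x" for x
    using G_le[OF f[of x]] G_le[of "-x" "- f x"] G_minus[OF f[of x]] by auto
  show ?thesis
    using that[OF bounded_linear_if_additive_bounded[OF f_diff f_bound]] unique[OF f G_sub] f_bound
    by blast
qed

section \<open>Densities of absolutely continuous signed measures\<close>

context finite_measure
begin

text \<open>The bound by a power of the measure acts twice: it forces continuity at the empty set,
  which turns finite into countable additivity, and it gives absolute continuity, so that
  Radon-Nikodym applies.\<close>

lemma density_of_nonneg_additive:
  fixes \<nu> :: "'a set \<Rightarrow> real"
  assumes add: "\<And>A B. A \<in> sets M \<Longrightarrow> B \<in> sets M \<Longrightarrow> A \<inter> B = {} \<Longrightarrow> \<nu> (A \<union> B) = \<nu> A + \<nu> B"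
    and nonneg: "\<And>A. A \<in> sets M \<Longrightarrow> 0 \<le> \<nu> A"
    and bound: "\<And>A. A \<in> sets M \<Longrightarrow> \<nu> A \<le> K * measure M A powr r" and r: "0 < r"
  shows "\<exists>f. integrable M f \<and> (\<forall>A\<in>sets M. \<nu> A = (\<integral>x\<in>A. f x \<partial>M))"
proof -
  define N where "N = measure_of (space M) (sets M) (\<lambda>A. ennreal (\<nu> A))"
  have \<nu>_0: "\<nu> {} = 0" using add[of "{}" "{}"] by simp
  have pos: "positive (sets M) (\<lambda>A. ennreal (\<nu> A))" by (simp add: positive_def \<nu>_0)
  have "countably_additive (sets M) (\<lambda>A. ennreal (\<nu> A))"
  proof (rule sets.empty_continuous_imp_countably_additive[OF pos])
    show "additive (sets M) (\<lambda>A. ennreal (\<nu> A))"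
      unfolding additive_def by (auto simp: add nonneg ennreal_plus[symmetric] simp del: ennreal_plus)
    show "\<forall>A\<in>sets M. ennreal (\<nu> A) \<noteq> \<infinity>" by simp
    fix A :: "nat \<Rightarrow> 'a set" assume A: "range A \<subseteq> sets M" "decseq A" "(\<Inter>i. A i) = {}"
    have "(\<lambda>i. measure M (A i)) \<longlonglongrightarrow> 0"
      using finite_Lim_measure_decseq[OF A(1,2)] A(3) by simp
    then have lim: "(\<lambda>i. K * measure M (A i) powr r) \<longlonglongrightarrow> 0"
      using r by (auto intro!: tendsto_eq_intros)
    have "(\<lambda>i. \<nu> (A i)) \<longlonglongrightarrow> 0"
      using A(1) by (intro tendsto_sandwich[OF _ _ tendsto_const lim]) (auto intro!: always_eventually bound nonneg)
    then show "(\<lambda>i. ennreal (\<nu> (A i))) \<longlonglongrightarrow> 0"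
      using tendsto_ennrealI by fastforce
  qed
  then have N: "emeasure N A = ennreal (\<nu> A)" if "A \<in> sets M" for A
    unfolding N_def using pos that
    by (intro emeasure_measure_of_sigma sets.sigma_algebra_axioms)
  have sets_N: "sets N = sets M" by (simp add: N_def)
  have "absolutely_continuous M N"
    unfolding absolutely_continuous_def
  proof (rule subsetI)
    fix A assume "A \<in> null_sets M"
    then have A: "A \<in> sets M" "measure M A = 0" by (auto simp: measure_def)
    then have "\<nu> A = 0" using bound[of A] nonneg[of A] by simp
    then show "A \<in> null_sets N" using A by (simp add: null_sets_def N sets_N)
  qed
  from Radon_Nikodym[OF this sets_N] obtain f where f [measurable]: "f \<in> borel_measurable M" "density M f = N"
    by blast
  have N_f: "(\<integral>\<^sup>+x. f x * indicator A x \<partial>M) = ennreal (\<nu> A)" if "A \<in> sets M" for A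
    using emeasure_density[OF f(1) that] N[OF that] f(2) by simp
  have "(\<integral>\<^sup>+x. f x \<partial>M) = (\<integral>\<^sup>+x. f x * indicator (space M) x \<partial>M)"
    by (intro nn_integral_cong) simp
  also have "\<dots> \<noteq> \<infinity>" by (subst N_f) auto
  finally have fin: "(\<integral>\<^sup>+x. f x \<partial>M) \<noteq> \<infinity>" .
  \<comment> \<open>The density takes values in \<open>ennreal\<close>. Its total mass is finite, so
    \<open>enn2real\<close> alters it only on a null set.\<close>
  have AE_fin: "AE x in M. f x \<noteq> \<infinity>" by (rule nn_integral_PInf_AE[OF f(1) fin])
  have real: "integrable M (\<lambda>x. enn2real (f x) * indicator A x) \<and>
      \<nu> A = (\<integral>x. enn2real (f x) * indicator A x \<partial>M)" if A [measurable]: "A \<in> sets M" for A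
  proof -
    have "(\<integral>\<^sup>+x. ennreal (enn2real (f x) * indicator A x) \<partial>M) = (\<integral>\<^sup>+x. f x * indicator A x \<partial>M)"
      using AE_fin by (intro nn_integral_cong_AE, eventually_elim)
        (auto simp: indicator_def ennreal_enn2real_if)
    then have "(\<integral>\<^sup>+x. ennreal (enn2real (f x) * indicator A x) \<partial>M) = ennreal (\<nu> A)"
      by (simp add: N_f A)
    moreover have "AE x in M. 0 \<le> enn2real (f x) * indicator A x" by simp
    moreover have "(\<lambda>x. enn2real (f x) * indicator A x) \<in> borel_measurable M" by measurable
    ultimately show ?thesis
      using nn_integral_eq_integrable[of "\<lambda>x. enn2real (f x) * indicator A x" M "\<nu> A"] nonneg[OF A]
      by auto
  qed
  have "integrable M (\<lambda>x. enn2real (f x))"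
    using conjunct1[OF real[OF sets.top]] by (rule Bochner_Integration.integrable_cong[THEN iffD1, rotated -1]) auto
  with real show ?thesis
    by (intro exI[of _ "\<lambda>x. enn2real (f x)"]) (simp add: set_lebesgue_integral_def mult.commute)
qed

text \<open>Jordan decomposition: \<open>\<nu>p\<close> is the positive variation, and both
  \<open>\<nu>p\<close> and \<open>\<nu>p - \<nu>\<close> are nonnegative, additive and bounded by a
  power of the measure.\<close>

lemma density_of_signed_additive:
  fixes \<nu> :: "'a set \<Rightarrow> real"
  assumes add: "\<And>A B. A \<in> sets M \<Longrightarrow> B \<in> sets M \<Longrightarrow> A \<inter> B = {} \<Longrightarrow> \<nu> (A \<union> B) = \<nu> A + \<nu> B"
    and bound: "\<And>A. A \<in> sets M \<Longrightarrow> \<bar>\<nu> A\<bar> \<le> K * measure M A powr r" and r: "0 < r" and K: "0 \<le> K"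
  shows "\<exists>f. integrable M f \<and> (\<forall>A\<in>sets M. \<nu> A = (\<integral>x\<in>A. f x \<partial>M))"
proof -
  define sub where "sub A = {B \<in> sets M. B \<subseteq> A}" for A
  define \<nu>p where "\<nu>p A = (SUP B\<in>sub A. \<nu> B)" for A
  have \<nu>_0: "\<nu> {} = 0" using add[of "{}" "{}"] by simp
  have sub_le: "\<nu> B \<le> K * measure M A powr r" if "A \<in> sets M" "B \<in> sub A" for A B
  proof -
    have "\<nu> B \<le> K * measure M B powr r" using bound[of B] that by (simp add: sub_def)
    also have "\<dots> \<le> K * measure M A powr r"
      using that r K by (intro mult_left_mono powr_mono2 finite_measure_mono) (auto simp: sub_def)
    finally show ?thesis .
  qed
  have bdd: "bdd_above (\<nu> ` sub A)" if "A \<in> sets M" for A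
    using sub_le[OF that] by (rule bdd_aboveI2)
  have empty_sub: "{} \<in> sub A" for A by (simp add: sub_def)
  have upper: "\<nu> B \<le> \<nu>p A" if "A \<in> sets M" "B \<in> sub A" for A B
    unfolding \<nu>p_def using that by (intro cSUP_upper bdd)
  have least: "\<nu>p A \<le> c" if "\<And>B. B \<in> sub A \<Longrightarrow> \<nu> B \<le> c" for A c
    unfolding \<nu>p_def using that empty_sub[of A] by (intro cSUP_least) auto
  have p_nonneg: "0 \<le> \<nu>p A" if "A \<in> sets M" for A
    using upper[OF that empty_sub] by (simp add: \<nu>_0)
  have p_le: "\<nu>p A \<le> K * measure M A powr r" if "A \<in> sets M" for A
    using sub_le[OF that] by (rule least)
  have p_ge: "\<nu> A \<le> \<nu>p A" if "A \<in> sets M" for A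
    using that by (intro upper) (simp_all add: sub_def)
  have p_add: "\<nu>p (A \<union> B) = \<nu>p A + \<nu>p B" if AB: "A \<in> sets M" "B \<in> sets M" "A \<inter> B = {}" for A B
  proof (rule antisym)
    show "\<nu>p (A \<union> B) \<le> \<nu>p A + \<nu>p B"
    proof (rule least)
      fix C assume C: "C \<in> sub (A \<union> B)"
      then have "C = (C \<inter> A) \<union> (C \<inter> B)" "C \<inter> A \<in> sub A" "C \<inter> B \<in> sub B"
        using AB by (auto simp: sub_def)
      moreover from this have "\<nu> ((C \<inter> A) \<union> (C \<inter> B)) = \<nu> (C \<inter> A) + \<nu> (C \<inter> B)"
        using AB by (intro add) (auto simp: sub_def)
      ultimately show "\<nu> C \<le> \<nu>p A + \<nu>p B"
        using upper[OF AB(1)] upper[OF AB(2)] add_mono by metis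
    qed
    have *: "\<nu> C + \<nu> D \<le> \<nu>p (A \<union> B)" if "C \<in> sub A" "D \<in> sub B" for C D
    proof -
      have "\<nu> (C \<union> D) = \<nu> C + \<nu> D" using that AB by (intro add) (auto simp: sub_def)
      moreover have "\<nu> (C \<union> D) \<le> \<nu>p (A \<union> B)"
        using that AB by (intro upper) (auto simp: sub_def)
      ultimately show ?thesis by simp
    qed
    have "\<nu>p A \<le> \<nu>p (A \<union> B) - \<nu> D" if "D \<in> sub B" for D
      using *[OF _ that] by (intro least) (simp add: le_diff_eq)
    then have "\<nu>p B \<le> \<nu>p (A \<union> B) - \<nu>p A"
      by (intro least) (simp add: algebra_simps)
    then show "\<nu>p A + \<nu>p B \<le> \<nu>p (A \<union> B)" by simp
  qed
  obtain f where f: "integrable M f" "\<And>A. A \<in> sets M \<Longrightarrow> \<nu>p A = (\<integral>x\<in>A. f x \<partial>M)"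
    using density_of_nonneg_additive[of \<nu>p K r] p_add p_nonneg p_le r by blast
  \<comment> \<open>One \<open>K\<close> comes from the positive variation, the other from
    \<open>- \<nu> A\<close>.\<close>
  have "\<nu>p A - \<nu> A \<le> (2 * K) * measure M A powr r" if "A \<in> sets M" for A
    using p_le[OF that] bound[OF that] by simp
  then obtain g where g: "integrable M g" "\<And>A. A \<in> sets M \<Longrightarrow> \<nu>p A - \<nu> A = (\<integral>x\<in>A. g x \<partial>M)"
    using density_of_nonneg_additive[of "\<lambda>A. \<nu>p A - \<nu> A" "2 * K" r] p_add p_ge add r by fastforce
  have "\<nu> A = (\<integral>x\<in>A. f x - g x \<partial>M)" if "A \<in> sets M" for A
  proof -
    have "set_integrable M A f" "set_integrable M A g"
      unfolding set_integrable_def using f(1) g(1) that by (simp_all add: integrable_mult_indicator del: real_scaleR_def)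
    then show ?thesis using f(2)[OF that] g(2)[OF that] by simp
  qed
  with f(1) g(1) show ?thesis by (intro exI[of _ "\<lambda>x. f x - g x"]) auto
qed

end

section \<open>Functionals on Bochner spaces\<close>

text \<open>\<open>F\<close> acts on functions instead of classes, so sums and multiples can be
  written pointwise; its compatibility with the classes is contained in \<open>bound\<close>.
  \<open>C\<close> is any bound, so that the norm can later take its place.\<close>

locale Lp_functional = prob_space M
  for M :: "'a measure" +
  fixes p q C :: real and F :: "('a \<Rightarrow> 'x::real_normed_vector) \<Rightarrow> real"
  assumes p: "1 < p" and pq: "1 / p + 1 / q = 1" and C_nonneg: "0 \<le> C"
    and add: "\<And>f g. f \<in> Lp_fun M p \<Longrightarrow> g \<in> Lp_fun M p \<Longrightarrow> F (\<lambda>\<omega>. f \<omega> + g \<omega>) = F f + F g"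
    and scale: "\<And>r f. f \<in> Lp_fun M p \<Longrightarrow> F (\<lambda>\<omega>. r *\<^sub>R f \<omega>) = r * F f"
    and bound: "\<And>f. f \<in> Lp_fun M p \<Longrightarrow> \<bar>F f\<bar> \<le> C * Lp_norm M p f"

lemma conjugate_exponent_gt_1:
  fixes p q :: real
  assumes "1 < p" "1 / p + 1 / q = 1"
  shows "1 < q"
proof -
  have "1 / q = 1 - 1 / p" using assms by simp
  then have "0 < 1 / q" "1 / q < 1" using assms(1) by auto
  then show ?thesis by (auto simp: divide_less_eq split: if_splits)
qed

lemma strongly_measurable_simple:
  assumes "simple_function M f"
  shows "strongly_measurable M f"
  using assms unfolding strongly_measurable_def by (intro exI[of _ "\<lambda>_. f"]) auto

lemma (in finite_measure) integrable_simple_function_real: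
  fixes f :: "'a \<Rightarrow> real"
  assumes "simple_function M f"
  shows "integrable M f"
proof (rule integrable_const_bound)
  have "finite (f ` space M)" using assms by (rule simple_functionD)
  then have "finite ((\<lambda>x. norm (f x)) ` space M)"
    using finite_imageI[of "f ` space M" norm] by (simp add: image_image)
  then show "AE x in M. norm (f x) \<le> Max ((\<lambda>x. norm (f x)) ` space M)"
    by (intro AE_I2 Max_ge) auto
  show "f \<in> borel_measurable M" using assms by (rule borel_measurable_simple_function)
qed

lemma (in finite_measure) Lp_fun_simple:
  fixes f :: "'a \<Rightarrow> 'x::real_normed_vector"
  assumes "simple_function M f"
  shows "f \<in> Lp_fun M p"
proof -
  have "simple_function M (\<lambda>\<omega>. norm (f \<omega>) powr p)"
    using simple_function_compose[OF assms, of "\<lambda>x. norm x powr p"] by (simp add: comp_def)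
  then show ?thesis
    using assms by (simp add: Lp_fun_def strongly_measurable_simple integrable_simple_function_real)
qed

context Lp_functional
begin

lemma q: "1 < q" using conjugate_exponent_gt_1[OF p pq] .

lemma p_nonneg: "0 \<le> p" using p by simp

lemma F_zero: "F (\<lambda>\<omega>. 0) = 0"
  using scale[OF Lp_fun_zero, of 0] by simp

lemma scale_closed: "f \<in> Lp_fun M p \<Longrightarrow> (\<lambda>\<omega>. r *\<^sub>R f \<omega>) \<in> Lp_fun M p"
  for f :: "'a \<Rightarrow> 'x"
  by (rule Lp_fun_scale[OF normed_scaling_scaleR])

lemma diff_closed:
  fixes f g :: "'a \<Rightarrow> 'x"
  assumes "f \<in> Lp_fun M p" "g \<in> Lp_fun M p"
  shows "(\<lambda>\<omega>. f \<omega> - g \<omega>) \<in> Lp_fun M p"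
  using Lp_fun_add[OF p_nonneg assms(1) scale_closed[OF assms(2), of "-1"]] by simp

lemma F_diff:
  assumes "f \<in> Lp_fun M p" "g \<in> Lp_fun M p"
  shows "F (\<lambda>\<omega>. f \<omega> - g \<omega>) = F f - F g"
  using add[OF assms(1) scale_closed[OF assms(2), of "-1"]] scale[OF assms(2), of "-1"] by simp

lemma sum_closed:
  fixes f :: "'i \<Rightarrow> 'a \<Rightarrow> 'x"
  assumes "\<And>i. i \<in> I \<Longrightarrow> f i \<in> Lp_fun M p"
  shows "(\<lambda>\<omega>. \<Sum>i\<in>I. f i \<omega>) \<in> Lp_fun M p"
  using assms by (induction I rule: infinite_finite_induct)
    (auto simp: Lp_fun_zero intro!: Lp_fun_add[OF p_nonneg])

lemma F_sum:
  assumes "\<And>i. i \<in> I \<Longrightarrow> f i \<in> Lp_fun M p"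
  shows "F (\<lambda>\<omega>. \<Sum>i\<in>I. f i \<omega>) = (\<Sum>i\<in>I. F (f i))"
  using assms by (induction I rule: infinite_finite_induct) (auto simp: F_zero add sum_closed)

text \<open>Functions that agree on \<open>space M\<close> may still differ outside it, so the bound
  is invoked: their difference has norm 0.\<close>

lemma F_cong:
  assumes "f \<in> Lp_fun M p" "g \<in> Lp_fun M p" "\<And>\<omega>. \<omega> \<in> space M \<Longrightarrow> f \<omega> = g \<omega>"
  shows "F f = F g"
proof -
  have "(\<integral>\<omega>. norm (f \<omega> - g \<omega>) powr p \<partial>M) = (\<integral>\<omega>. 0 \<partial>M)"
    using assms(3) by (intro Bochner_Integration.integral_cong) auto
  then show ?thesis
    using bound[OF diff_closed[OF assms(1,2)]] F_diff[OF assms(1,2)] by (simp add: Lp_norm_def)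
qed

section \<open>Scalar densities of a functional\<close>

definition has_density :: "'x \<Rightarrow> ('a \<Rightarrow> real) \<Rightarrow> bool" where
  "has_density v g \<longleftrightarrow> integrable M g \<and>
     (\<forall>A\<in>sets M. F (\<lambda>\<omega>. indicator A \<omega> *\<^sub>R v) = (\<integral>\<omega>\<in>A. g \<omega> \<partial>M))"

lemma indicator_closed: "A \<in> sets M \<Longrightarrow> (\<lambda>\<omega>. indicator A \<omega> *\<^sub>R v) \<in> Lp_fun M p"
  for v :: 'x
proof (rule Lp_fun_simple)
  assume "A \<in> sets M"
  then have "simple_function M (indicator A :: 'a \<Rightarrow> real)" by (rule simple_function_indicator)
  from simple_function_compose[OF this, of "\<lambda>r. r *\<^sub>R v"]
  show "simple_function M (\<lambda>\<omega>. indicator A \<omega> *\<^sub>R v)" by (simp add: comp_def)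
qed

text \<open>The indicator of \<open>A\<close> times \<open>v\<close> has norm
  \<open>measure M A powr (1 / p) * norm v\<close>, so for fixed \<open>v\<close> the set function
  is dominated by a power of the measure.\<close>

lemma has_density_exists: "\<exists>g. has_density v g"
proof -
  define \<nu> where "\<nu> A = F (\<lambda>\<omega>. indicator A \<omega> *\<^sub>R v)" for A
  have "\<exists>f. integrable M f \<and> (\<forall>A\<in>sets M. \<nu> A = (\<integral>x\<in>A. f x \<partial>M))"
  proof (rule density_of_signed_additive)
    show "\<nu> (A \<union> B) = \<nu> A + \<nu> B" if "A \<in> sets M" "B \<in> sets M" "A \<inter> B = {}" for A B
    proof -
      have "(\<lambda>\<omega>. indicator (A \<union> B) \<omega> *\<^sub>R v) = (\<lambda>\<omega>. indicator A \<omega> *\<^sub>R v + indicator B \<omega> *\<^sub>R v)"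
        using that(3) by (auto simp: indicator_def fun_eq_iff)
      then show ?thesis using that by (simp add: \<nu>_def add indicator_closed)
    qed
    show "\<bar>\<nu> A\<bar> \<le> (C * norm v) * measure M A powr (1 / p)" if A: "A \<in> sets M" for A
    proof -
      have "(\<integral>\<omega>. norm (indicator A \<omega> *\<^sub>R v) powr p \<partial>M) = (\<integral>\<omega>. indicator A \<omega> * norm v powr p \<partial>M)"
        by (intro Bochner_Integration.integral_cong) (auto simp: indicator_def)
      also have "\<dots> = measure M A * norm v powr p" using A by simp
      finally have "Lp_norm M p (\<lambda>\<omega>. indicator A \<omega> *\<^sub>R v) = measure M A powr (1 / p) * norm v"
        unfolding Lp_norm_def using p by (simp only: powr_mult powr_powr) simp
      then show ?thesis
        using bound[OF indicator_closed[OF A], of v] by (simp add: \<nu>_def mult_ac)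
    qed
    show "0 < 1 / p" "0 \<le> C * norm v" using p C_nonneg by auto
  qed
  then show ?thesis by (simp add: has_density_def \<nu>_def)
qed

lemma has_densityD_simple:
  assumes g: "has_density v g" and a: "simple_function M a"
  shows "integrable M (\<lambda>\<omega>. a \<omega> * g \<omega>)"
    and "F (\<lambda>\<omega>. a \<omega> *\<^sub>R v) = (\<integral>\<omega>. a \<omega> * g \<omega> \<partial>M)"
    and "(\<lambda>\<omega>. a \<omega> *\<^sub>R v) \<in> Lp_fun M p"
proof -
  define R where "R = a ` space M"
  define A where "A r = a -` {r} \<inter> space M" for r
  have fin: "finite R" using a unfolding R_def by (rule simple_functionD)
  have A: "A r \<in> sets M" for r unfolding A_def by (rule simple_functionD[OF a])
  have rep: "a \<omega> = (\<Sum>r\<in>R. r * indicator (A r) \<omega>)" if "\<omega> \<in> space M" for \<omega>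
  proof -
    have "(\<Sum>r\<in>R. r * indicator (A r) \<omega>) = (\<Sum>r\<in>R. if r = a \<omega> then r else 0)"
      using that by (intro sum.cong) (auto simp: A_def indicator_def)
    also have "\<dots> = a \<omega>" using fin that by (simp add: R_def)
    finally show ?thesis by simp
  qed
  show closed: "(\<lambda>\<omega>. a \<omega> *\<^sub>R v) \<in> Lp_fun M p"
    using simple_function_compose[OF a, of "\<lambda>r. r *\<^sub>R v"] by (intro Lp_fun_simple) (simp add: comp_def)
  have int: "integrable M (\<lambda>\<omega>. indicator (A r) \<omega> * g \<omega>)" for r
    using integrable_mult_indicator[OF A, of g] g by (simp add: has_density_def)
  have "integrable M (\<lambda>\<omega>. \<Sum>r\<in>R. r * (indicator (A r) \<omega> * g \<omega>))"
    by (intro Bochner_Integration.integrable_sum integrable_mult_right int)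
  moreover have eq: "(\<Sum>r\<in>R. r * (indicator (A r) \<omega> * g \<omega>)) = a \<omega> * g \<omega>" if "\<omega> \<in> space M" for \<omega>
    by (simp add: rep[OF that] sum_distrib_right mult.assoc)
  ultimately show "integrable M (\<lambda>\<omega>. a \<omega> * g \<omega>)"
    by (rule Bochner_Integration.integrable_cong[OF refl, THEN iffD1, rotated]) auto
  have "F (\<lambda>\<omega>. a \<omega> *\<^sub>R v) = F (\<lambda>\<omega>. \<Sum>r\<in>R. r *\<^sub>R (indicator (A r) \<omega> *\<^sub>R v))"
    using A closed by (intro F_cong sum_closed scale_closed indicator_closed)
      (auto simp: rep scaleR_sum_left)
  also have "\<dots> = (\<Sum>r\<in>R. F (\<lambda>\<omega>. r *\<^sub>R (indicator (A r) \<omega> *\<^sub>R v)))"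
    using A by (intro F_sum scale_closed indicator_closed)
  also have "\<dots> = (\<Sum>r\<in>R. r * (\<integral>\<omega>. indicator (A r) \<omega> * g \<omega> \<partial>M))"
    using g A by (simp only: scale[OF indicator_closed] has_density_def set_lebesgue_integral_def real_scaleR_def)
  also have "\<dots> = (\<integral>\<omega>. (\<Sum>r\<in>R. r * (indicator (A r) \<omega> * g \<omega>)) \<partial>M)"
    using int by (subst Bochner_Integration.integral_sum) auto
  also have "\<dots> = (\<integral>\<omega>. a \<omega> * g \<omega> \<partial>M)"
    by (intro Bochner_Integration.integral_cong refl eq)
  finally show "F (\<lambda>\<omega>. a \<omega> *\<^sub>R v) = (\<integral>\<omega>. a \<omega> * g \<omega> \<partial>M)" .
qed

text \<open>On the fibre where \<open>x\<close> takes the value \<open>v\<close> the density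
  \<open>g v\<close> applies, so the integrand is the density selected by the current value of
  \<open>x\<close>. This replaces the pairing with a dual-valued function, which may not
  exist.\<close>

lemma F_simple:
  assumes x: "simple_function M x" and g: "\<And>v. v \<in> x ` space M \<Longrightarrow> has_density v (g v)"
  shows "integrable M (\<lambda>\<omega>. g (x \<omega>) \<omega>)" "F x = (\<integral>\<omega>. g (x \<omega>) \<omega> \<partial>M)"
proof -
  define R where "R = x ` space M"
  define A where "A v = x -` {v} \<inter> space M" for v
  have fin: "finite R" using x unfolding R_def by (rule simple_functionD)
  have A: "A v \<in> sets M" for v unfolding A_def by (rule simple_functionD[OF x])
  \<comment> \<open>At each point exactly one fibre indicator is 1. \<open>h\<close> is generic
    because the rule serves both vectors and reals.\<close>
  have delta: "(\<Sum>v\<in>R. h v (indicator (A v) \<omega>)) = h (x \<omega>) 1"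
    if "\<omega> \<in> space M" "\<And>v. h v 0 = 0" for \<omega> and h :: "'x \<Rightarrow> real \<Rightarrow> 'c::comm_monoid_add"
  proof -
    have "(\<Sum>v\<in>R. h v (indicator (A v) \<omega>)) = (\<Sum>v\<in>R. if v = x \<omega> then h v 1 else 0)"
      using that by (intro sum.cong) (auto simp: A_def indicator_def)
    also have "\<dots> = h (x \<omega>) 1" using fin that by (simp add: R_def)
    finally show ?thesis .
  qed
  have ind: "simple_function M (indicator (A v) :: 'a \<Rightarrow> real)" for v
    using A by (rule simple_function_indicator)
  have g': "has_density v (g v)" if "v \<in> R" for v using g that by (simp add: R_def)
  note dens = has_densityD_simple[OF g' ind]
  have "F x = F (\<lambda>\<omega>. \<Sum>v\<in>R. indicator (A v) \<omega> *\<^sub>R v)"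
    using delta[of _ "\<lambda>v r. r *\<^sub>R v"] x
    by (intro F_cong sum_closed dens(3) Lp_fun_simple) auto
  also have "\<dots> = (\<Sum>v\<in>R. \<integral>\<omega>. indicator (A v) \<omega> * g v \<omega> \<partial>M)"
    by (subst F_sum) (auto simp: dens)
  also have "\<dots> = (\<integral>\<omega>. (\<Sum>v\<in>R. indicator (A v) \<omega> * g v \<omega>) \<partial>M)"
    using dens(1) by (subst Bochner_Integration.integral_sum) auto
  also have "\<dots> = (\<integral>\<omega>. g (x \<omega>) \<omega> \<partial>M)"
    using delta[of _ "\<lambda>v r. r * g v \<omega>" for \<omega>] by (intro Bochner_Integration.integral_cong) auto
  finally show "F x = (\<integral>\<omega>. g (x \<omega>) \<omega> \<partial>M)" .
  have "integrable M (\<lambda>\<omega>. \<Sum>v\<in>R. indicator (A v) \<omega> * g v \<omega>)"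
    by (intro Bochner_Integration.integrable_sum dens(1))
  then show "integrable M (\<lambda>\<omega>. g (x \<omega>) \<omega>)"
    using delta[of _ "\<lambda>v r. r * g v \<omega>" for \<omega>]
    by (subst (asm) Bochner_Integration.integrable_cong[OF refl]) auto
qed

end

section \<open>Integrability of the norm of countably many densities\<close>

context Lp_functional
begin

text \<open>Duality test: where index \<open>i\<close> attains the maximum \<open>w\<close>, the
  test function points along \<open>s i\<close> with the sign of \<open>g i\<close> and has length
  at most \<open>v powr (1 / p)\<close>. Then \<open>F\<close> of it is at least the integral J of
  \<open>v\<close>, while its norm is at most J^(1/p), so J <= C J^(1/p) and J^(1/q) <= C. A simple
  \<open>v\<close> below \<open>w powr q\<close> keeps J finite, so that J^(1/p) can be cancelled,
  and keeps the coefficients of the test function simple.\<close>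

lemma simple_integral_le_if_le_Max:
  fixes s :: "nat \<Rightarrow> 'x" and g :: "nat \<Rightarrow> 'a \<Rightarrow> real" and k :: nat
  defines "w \<equiv> \<lambda>\<omega>. Max ((\<lambda>i. \<bar>g i \<omega>\<bar> / norm (s i)) ` {..k})"
  assumes g: "\<And>i. has_density (s i) (g i)"
    and v: "simple_function M v" "\<And>\<omega>. \<omega> \<in> space M \<Longrightarrow> 0 \<le> v \<omega>" "\<And>\<omega>. \<omega> \<in> space M \<Longrightarrow> v \<omega> \<le> w \<omega> powr q"
  shows "(\<integral>\<omega>. v \<omega> \<partial>M) \<le> C powr q"
proof -
  define r where "r i \<omega> = \<bar>g i \<omega>\<bar> / norm (s i)" for i \<omega>
  have w_def': "w \<omega> = Max ((\<lambda>i. r i \<omega>) ` {..k})" for \<omega> by (simp add: w_def r_def)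
  have g_meas [measurable]: "g i \<in> borel_measurable M" for i
    using g by (auto simp: has_density_def)
  have r_meas [measurable]: "r i \<in> borel_measurable M" for i
    unfolding r_def by measurable
  have w_meas [measurable]: "w \<in> borel_measurable M"
    unfolding w_def' by (rule borel_measurable_Max) auto
  have w_nonneg: "0 \<le> w \<omega>" for \<omega>
    unfolding w_def' by (rule Max_ge_iff[THEN iffD2]) (auto simp: r_def)
  \<comment> \<open>Ties go to the least index, which makes the sets \<open>A i\<close>
    disjoint.\<close>
  define A where "A i = {\<omega> \<in> space M. r i \<omega> = w \<omega> \<and> (\<forall>j\<in>{..<i}. r j \<omega> \<noteq> w \<omega>)}" for i
  have A: "A i \<in> sets M" for i unfolding A_def by measurable
  define sel where "sel \<omega> = (LEAST i. r i \<omega> = w \<omega>)" for \<omega>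
  have sel: "sel \<omega> \<le> k" "r (sel \<omega>) \<omega> = w \<omega>" for \<omega>
  proof -
    have "w \<omega> \<in> (\<lambda>i. r i \<omega>) ` {..k}" unfolding w_def' by (rule Max_in) auto
    then obtain i where i: "i \<le> k" "r i \<omega> = w \<omega>" by auto
    then show "sel \<omega> \<le> k" using Least_le[of "\<lambda>i. r i \<omega> = w \<omega>" i] by (simp add: sel_def)
    show "r (sel \<omega>) \<omega> = w \<omega>" unfolding sel_def by (rule LeastI, rule i)
  qed
  have A_iff: "\<omega> \<in> A i \<longleftrightarrow> i = sel \<omega>" if "\<omega> \<in> space M" for \<omega> i
  proof
    assume i: "\<omega> \<in> A i"
    have "\<not> sel \<omega> < i" using i sel(2)[of \<omega>] by (auto simp: A_def)
    moreover have "sel \<omega> \<le> i" unfolding sel_def using i by (intro Least_le) (simp add: A_def)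
    ultimately show "i = sel \<omega>" by simp
  next
    assume "i = sel \<omega>"
    moreover have "r j \<omega> \<noteq> w \<omega>" if "j < sel \<omega>" for j
      using not_less_Least[of j "\<lambda>i. r i \<omega> = w \<omega>"] that by (simp add: sel_def)
    ultimately show "\<omega> \<in> A i" unfolding A_def using that sel(2)[of \<omega>] by blast
  qed
  define u where "u \<omega> = v \<omega> powr (1 / p)" for \<omega>
  define a where "a i \<omega> = u \<omega> * (indicator (A i) \<omega> * (sgn (g i \<omega>) / norm (s i)))" for i \<omega>
  have u: "simple_function M u"
    using simple_function_compose[OF v(1), of "\<lambda>y. y powr (1 / p)"] by (simp add: u_def[abs_def] comp_def)
  have "simple_function M (\<lambda>\<omega>. sgn (g i \<omega>) / norm (s i))" for i
  proof (rule simple_function_borel_measurable)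
    show "finite ((\<lambda>\<omega>. sgn (g i \<omega>) / norm (s i)) ` space M)"
      by (rule finite_subset[of _ "{-1 / norm (s i), 0, 1 / norm (s i)}"]) (auto simp: sgn_if split: if_splits)
    show "(\<lambda>\<omega>. sgn (g i \<omega>) / norm (s i)) \<in> borel_measurable M" unfolding sgn_if by measurable
  qed
  then have a: "simple_function M (a i)" for i
    unfolding a_def using A u by (intro simple_function_mult simple_function_indicator)
  have delta: "(\<Sum>i\<le>k. h i (indicator (A i) \<omega>)) = h (sel \<omega>) 1"
    if "\<omega> \<in> space M" "\<And>i. h i 0 = 0" for \<omega> and h :: "nat \<Rightarrow> real \<Rightarrow> 'c::comm_monoid_add"
  proof -
    have "(\<Sum>i\<le>k. h i (indicator (A i) \<omega>)) = (\<Sum>i\<le>k. if i = sel \<omega> then h i 1 else 0)"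
      using that by (intro sum.cong) (auto simp: A_iff indicator_def)
    also have "\<dots> = h (sel \<omega>) 1" using sel(1)[of \<omega>] by simp
    finally show ?thesis .
  qed
  define x where "x \<omega> = (\<Sum>i\<le>k. a i \<omega> *\<^sub>R s i)" for \<omega>
  note dens = has_densityD_simple[OF g a]
  have x: "x \<in> Lp_fun M p" unfolding x_def by (intro sum_closed dens(3))
  \<comment> \<open>Only an inequality, because \<open>x\<close> is 0 wherever the selected density
    or the selected vector is 0.\<close>
  have x_le: "norm (x \<omega>) powr p \<le> v \<omega>" if "\<omega> \<in> space M" for \<omega>
  proof -
    have "x \<omega> = (u \<omega> * (sgn (g (sel \<omega>) \<omega>) / norm (s (sel \<omega>)))) *\<^sub>R s (sel \<omega>)"
      unfolding x_def a_def
      using delta[OF that, of "\<lambda>i y. (u \<omega> * (y * (sgn (g i \<omega>) / norm (s i)))) *\<^sub>R s i"] by simp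
    then have "norm (x \<omega>) \<le> u \<omega>"
      by (auto simp: abs_mult sgn_if u_def)
    then have "norm (x \<omega>) powr p \<le> u \<omega> powr p" using p by (intro powr_mono2) auto
    also have "\<dots> = v \<omega>" using p v(2)[OF that] by (simp add: u_def powr_powr)
    finally show ?thesis .
  qed
  have int_v: "integrable M v" using v(1) by (rule integrable_simple_function_real)
  define J where "J = (\<integral>\<omega>. v \<omega> \<partial>M)"
  have J_nonneg: "0 \<le> J" unfolding J_def using v(2) by (intro Bochner_Integration.integral_nonneg) auto
  have "J \<le> (\<integral>\<omega>. (\<Sum>i\<le>k. a i \<omega> * g i \<omega>) \<partial>M)"
    unfolding J_def
  proof (rule integral_mono[OF int_v])
    show "integrable M (\<lambda>\<omega>. \<Sum>i\<le>k. a i \<omega> * g i \<omega>)"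
      by (intro Bochner_Integration.integrable_sum dens(1))
    fix \<omega> assume \<omega>: "\<omega> \<in> space M"
    have "(\<Sum>i\<le>k. a i \<omega> * g i \<omega>) = u \<omega> * (sgn (g (sel \<omega>) \<omega>) / norm (s (sel \<omega>))) * g (sel \<omega>) \<omega>"
      unfolding a_def
      using delta[OF \<omega>, of "\<lambda>i y. (u \<omega> * (y * (sgn (g i \<omega>) / norm (s i)))) * g i \<omega>"] by simp
    also have "\<dots> = u \<omega> * r (sel \<omega>) \<omega>" by (simp add: r_def abs_sgn mult_ac)
    also have "\<dots> = u \<omega> * w \<omega>" by (simp add: sel)
    finally have eq: "(\<Sum>i\<le>k. a i \<omega> * g i \<omega>) = u \<omega> * w \<omega>" .
    have "v \<omega> powr (1 / q) \<le> (w \<omega> powr q) powr (1 / q)"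
      using v(2,3)[OF \<omega>] q by (intro powr_mono2) auto
    also have "\<dots> = w \<omega>" using q w_nonneg by (simp add: powr_powr)
    finally have "u \<omega> * v \<omega> powr (1 / q) \<le> u \<omega> * w \<omega>" by (intro mult_left_mono) (auto simp: u_def)
    moreover have "u \<omega> * v \<omega> powr (1 / q) = v \<omega>"
      using v(2)[OF \<omega>] by (simp add: u_def powr_add[symmetric] pq)
    ultimately show "v \<omega> \<le> (\<Sum>i\<le>k. a i \<omega> * g i \<omega>)" by (simp add: eq)
  qed
  also have "\<dots> = (\<Sum>i\<le>k. F (\<lambda>\<omega>. a i \<omega> *\<^sub>R s i))"
    using dens(1) by (subst Bochner_Integration.integral_sum) (auto simp: dens(2))
  also have "\<dots> = F x" unfolding x_def by (rule F_sum[symmetric]) (rule dens(3))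
  also have "\<dots> \<le> C * Lp_norm M p x" using bound[OF x] by simp
  also have "\<dots> \<le> C * J powr (1 / p)"
    unfolding Lp_norm_def J_def using C_nonneg p x int_v x_le
    by (intro mult_left_mono powr_mono2 integral_mono) (auto simp: Lp_fun_def)
  finally have le: "J \<le> C * J powr (1 / p)" .
  have "J \<le> C powr q"
  proof (cases "J = 0")
    case False
    with J_nonneg have J: "0 < J" by simp
    have "J powr (1 / p) * J powr (1 / q) = J" using J by (simp add: powr_add[symmetric] pq)
    with le have "J powr (1 / p) * J powr (1 / q) \<le> J powr (1 / p) * C" by (simp add: mult.commute)
    then have "J powr (1 / q) \<le> C" using J by simp
    then have "(J powr (1 / q)) powr q \<le> C powr q" using q by (intro powr_mono2) auto
    then show ?thesis using J q by (simp add: powr_powr)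
  qed simp
  then show ?thesis by (simp add: J_def)
qed

text \<open>The nonnegative integral is a supremum over simple functions with finite values, and the
  duality test applies to each of them. No integrability of the maximum has to be known
  beforehand.\<close>

lemma nn_integral_Max_le:
  fixes s :: "nat \<Rightarrow> 'x" and g :: "nat \<Rightarrow> 'a \<Rightarrow> real"
  assumes g: "\<And>i. has_density (s i) (g i)"
  shows "(\<integral>\<^sup>+\<omega>. ennreal (Max ((\<lambda>i. \<bar>g i \<omega>\<bar> / norm (s i)) ` {..k}) powr q) \<partial>M) \<le> ennreal (C powr q)"
proof -
  let ?w = "\<lambda>\<omega>. Max ((\<lambda>i. \<bar>g i \<omega>\<bar> / norm (s i)) ` {..k})"
  show ?thesis
    unfolding nn_integral_def_finite
  proof (rule SUP_least, elim CollectE conjE)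
    fix h assume h: "simple_function M h" "h \<le> (\<lambda>\<omega>. ennreal (?w \<omega> powr q))" "\<forall>\<omega>. h \<omega> < top"
    define v where "v \<omega> = enn2real (h \<omega>)" for \<omega>
    have hv: "h \<omega> = ennreal (v \<omega>)" for \<omega> using h(3) by (simp add: v_def)
    have v_nonneg: "0 \<le> v \<omega>" for \<omega> by (simp add: v_def)
    have v: "simple_function M v"
      using simple_function_compose[OF h(1), of enn2real] by (simp add: v_def[abs_def] comp_def)
    have "v \<omega> \<le> ?w \<omega> powr q" for \<omega>
      using le_funD[OF h(2), of \<omega>] by (simp add: hv)
    then have "(\<integral>\<omega>. v \<omega> \<partial>M) \<le> C powr q"
      by (intro simple_integral_le_if_le_Max[OF g v]) (simp_all add: v_nonneg)
    moreover have "integral\<^sup>S M h = (\<integral>\<^sup>+\<omega>. h \<omega> \<partial>M)" using h(1) by (rule nn_integral_eq_simple_integral[symmetric])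
    moreover have "(\<integral>\<^sup>+\<omega>. h \<omega> \<partial>M) = ennreal (\<integral>\<omega>. v \<omega> \<partial>M)"
      unfolding hv by (intro nn_integral_eq_integral integrable_simple_function_real v) (auto simp: v_def)
    ultimately show "integral\<^sup>S M h \<le> ennreal (C powr q)"
      by (simp add: ennreal_leI)
  qed
qed

text \<open>The bound is uniform in \<open>k\<close>, so monotone convergence carries it to the
  supremum. The supremum is formed in \<open>ennreal\<close> because boundedness is only being
  established here: a finite integral makes it finite almost everywhere.\<close>

lemma
  fixes s :: "nat \<Rightarrow> 'x" and g :: "nat \<Rightarrow> 'a \<Rightarrow> real"
  assumes g: "\<And>i. has_density (s i) (g i)"
  shows AE_bdd_above_density: "AE \<omega> in M. bdd_above (range (\<lambda>i. \<bar>g i \<omega>\<bar> / norm (s i)))"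
    and nn_integral_SUP_Max_le:
      "(\<integral>\<^sup>+\<omega>. (SUP k. ennreal (Max ((\<lambda>i. \<bar>g i \<omega>\<bar> / norm (s i)) ` {..k}) powr q)) \<partial>M) \<le> ennreal (C powr q)"
proof -
  define w where "w k \<omega> = Max ((\<lambda>i. \<bar>g i \<omega>\<bar> / norm (s i)) ` {..k})" for k \<omega>
  have g_meas [measurable]: "g i \<in> borel_measurable M" for i
    using g by (auto simp: has_density_def)
  have w_meas [measurable]: "w k \<in> borel_measurable M" for k
    unfolding w_def by (rule borel_measurable_Max) auto
  have w_ge: "\<bar>g i \<omega>\<bar> / norm (s i) \<le> w k \<omega>" if "i \<le> k" for i k \<omega>
    unfolding w_def using that by (intro Max_ge) auto
  have w_nonneg: "0 \<le> w k \<omega>" for k \<omega> by (rule order_trans[OF _ w_ge[of 0]]) auto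
  have w_mono: "w k \<omega> \<le> w l \<omega>" if "k \<le> l" for k l \<omega>
    unfolding w_def using that by (intro Max_mono) auto
  have inc: "incseq (\<lambda>k \<omega>. ennreal (w k \<omega> powr q))"
    using w_mono w_nonneg q by (auto simp: incseq_def le_fun_def intro!: ennreal_leI powr_mono2)
  have "(\<integral>\<^sup>+\<omega>. (SUP k. ennreal (w k \<omega> powr q)) \<partial>M) = (SUP k. \<integral>\<^sup>+\<omega>. ennreal (w k \<omega> powr q) \<partial>M)"
    by (intro nn_integral_monotone_convergence_SUP inc) measurable
  also have "\<dots> \<le> ennreal (C powr q)"
    using nn_integral_Max_le[OF g] unfolding w_def by (intro SUP_least)
  finally have le: "(\<integral>\<^sup>+\<omega>. (SUP k. ennreal (w k \<omega> powr q)) \<partial>M) \<le> ennreal (C powr q)" .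
  then show "(\<integral>\<^sup>+\<omega>. (SUP k. ennreal (Max ((\<lambda>i. \<bar>g i \<omega>\<bar> / norm (s i)) ` {..k}) powr q)) \<partial>M) \<le> ennreal (C powr q)"
    by (simp only: w_def)
  have "AE \<omega> in M. (SUP k. ennreal (w k \<omega> powr q)) \<noteq> \<infinity>"
  proof (rule nn_integral_PInf_AE)
    show "(\<integral>\<^sup>+\<omega>. (SUP k. ennreal (w k \<omega> powr q)) \<partial>M) \<noteq> \<infinity>"
      using le by (auto simp: top_unique)
  qed measurable
  then show "AE \<omega> in M. bdd_above (range (\<lambda>i. \<bar>g i \<omega>\<bar> / norm (s i)))"
  proof eventually_elim
    fix \<omega> assume "(SUP k. ennreal (w k \<omega> powr q)) \<noteq> \<infinity>"
    then obtain B where B: "(SUP k. ennreal (w k \<omega> powr q)) = ennreal B" "0 \<le> B"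
      by (cases "SUP k. ennreal (w k \<omega> powr q)") auto
    have "\<bar>g i \<omega>\<bar> / norm (s i) \<le> B powr (1 / q)" for i
    proof -
      have "ennreal (w i \<omega> powr q) \<le> ennreal B" unfolding B(1)[symmetric] by (rule SUP_upper) simp
      then have "w i \<omega> powr q \<le> B" using B(2) by simp
      then have "(w i \<omega> powr q) powr (1 / q) \<le> B powr (1 / q)" using q by (intro powr_mono2) auto
      then show ?thesis using w_ge[of i i \<omega>] w_nonneg[of i \<omega>] q by (simp add: powr_powr)
    qed
    then show "bdd_above (range (\<lambda>i. \<bar>g i \<omega>\<bar> / norm (s i)))" by (rule bdd_aboveI2)
  qed
qed

text \<open>A real supremum is meaningful only for bounded families, hence \<open>bdd\<close> at
  every point. It is compared with the extended supremum of the finite maxima, whose integral is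
  already bounded.\<close>

lemma integral_SUP_density_le:
  fixes s :: "nat \<Rightarrow> 'x" and g :: "nat \<Rightarrow> 'a \<Rightarrow> real"
  assumes g: "\<And>i. has_density (s i) (g i)"
    and bdd: "\<And>\<omega>. bdd_above (range (\<lambda>i. \<bar>g i \<omega>\<bar> / norm (s i)))"
  shows "integrable M (\<lambda>\<omega>. (SUP i. \<bar>g i \<omega>\<bar> / norm (s i)) powr q)"
    and "(\<integral>\<omega>. (SUP i. \<bar>g i \<omega>\<bar> / norm (s i)) powr q \<partial>M) \<le> C powr q"
proof -
  define n where "n \<omega> = (SUP i. \<bar>g i \<omega>\<bar> / norm (s i))" for \<omega>
  define w where "w k \<omega> = Max ((\<lambda>i. \<bar>g i \<omega>\<bar> / norm (s i)) ` {..k})" for k \<omega>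
  have g_meas [measurable]: "g i \<in> borel_measurable M" for i
    using g by (auto simp: has_density_def)
  have n_meas [measurable]: "n \<in> borel_measurable M"
    unfolding n_def by (rule borel_measurable_cSUP) (auto simp: bdd)
  have w_nonneg: "0 \<le> w k \<omega>" for k \<omega>
    unfolding w_def by (rule Max_ge_iff[THEN iffD2]) auto
  have n_nonneg: "0 \<le> n \<omega>" for \<omega>
    unfolding n_def by (rule cSUP_upper2[OF bdd, of 0]) auto
  have n_le: "ennreal (n \<omega> powr q) \<le> (SUP k. ennreal (w k \<omega> powr q))" for \<omega>
  proof (cases "SUP k. ennreal (w k \<omega> powr q)")
    case (real B)
    have "\<bar>g i \<omega>\<bar> / norm (s i) \<le> B powr (1 / q)" for i
    proof -
      have "ennreal (w i \<omega> powr q) \<le> ennreal B" unfolding real(2)[symmetric] by (rule SUP_upper) simp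
      then have "w i \<omega> powr q \<le> B" using real by simp
      then have "(w i \<omega> powr q) powr (1 / q) \<le> B powr (1 / q)" using q by (intro powr_mono2) auto
      then have "w i \<omega> \<le> B powr (1 / q)" using w_nonneg[of i \<omega>] q by (simp add: powr_powr)
      moreover have "\<bar>g i \<omega>\<bar> / norm (s i) \<le> w i \<omega>" unfolding w_def by (intro Max_ge) auto
      ultimately show ?thesis by linarith
    qed
    then have "n \<omega> \<le> B powr (1 / q)" unfolding n_def by (intro cSUP_least) auto
    then have "n \<omega> powr q \<le> (B powr (1 / q)) powr q" using q n_nonneg by (intro powr_mono2) auto
    then show ?thesis using real q by (simp add: powr_powr ennreal_leI)
  next
    case top
    then show ?thesis by (simp only: top_greatest)
  qed
  have le: "(\<integral>\<^sup>+\<omega>. ennreal (n \<omega> powr q) \<partial>M) \<le> ennreal (C powr q)"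
    using nn_integral_mono[OF n_le] nn_integral_SUP_Max_le[OF g] unfolding w_def by (rule order_trans)
  then have int: "integrable M (\<lambda>\<omega>. n \<omega> powr q)"
    by (intro integrableI_nonneg) (auto simp: le_less_trans)
  then show "integrable M (\<lambda>\<omega>. (SUP i. \<bar>g i \<omega>\<bar> / norm (s i)) powr q)" by (simp add: n_def)
  have "ennreal (\<integral>\<omega>. n \<omega> powr q \<partial>M) \<le> ennreal (C powr q)"
    using le int by (subst (asm) nn_integral_eq_integral) auto
  then show "(\<integral>\<omega>. (SUP i. \<bar>g i \<omega>\<bar> / norm (s i)) powr q \<partial>M) \<le> C powr q"
    by (simp add: n_def)
qed

section \<open>Correction of densities on a null set\<close>

lemma has_density_cong_AE:
  assumes "has_density v g" "AE \<omega> in M. g \<omega> = g' \<omega>" "g' \<in> borel_measurable M"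
  shows "has_density v g'"
proof -
  have [measurable]: "g \<in> borel_measurable M" "g' \<in> borel_measurable M"
    using assms by (auto simp: has_density_def)
  have "integrable M g'"
    using assms by (subst integrable_cong_AE[of g' M g]) (auto simp: has_density_def)
  moreover have "(\<integral>\<omega>\<in>A. g \<omega> \<partial>M) = (\<integral>\<omega>\<in>A. g' \<omega> \<partial>M)" if [measurable]: "A \<in> sets M" for A
    unfolding set_lebesgue_integral_def using assms(2) by (intro integral_cong_AE) auto
  ultimately show ?thesis using assms(1) by (simp add: has_density_def)
qed

lemma has_density_diff:
  assumes "has_density u f" "has_density v g"
  shows "has_density (u - v) (\<lambda>\<omega>. f \<omega> - g \<omega>)"
  unfolding has_density_def
proof (intro conjI ballI)
  show "integrable M (\<lambda>\<omega>. f \<omega> - g \<omega>)" using assms by (auto simp: has_density_def)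
  fix A assume A: "A \<in> sets M"
  have "set_integrable M A f" "set_integrable M A g"
    unfolding set_integrable_def using assms A
    by (simp_all add: has_density_def integrable_mult_indicator del: real_scaleR_def)
  then have "(\<integral>\<omega>\<in>A. f \<omega> - g \<omega> \<partial>M) = (\<integral>\<omega>\<in>A. f \<omega> \<partial>M) - (\<integral>\<omega>\<in>A. g \<omega> \<partial>M)" by simp
  also have "\<dots> = F (\<lambda>\<omega>. indicator A \<omega> *\<^sub>R u) - F (\<lambda>\<omega>. indicator A \<omega> *\<^sub>R v)"
    using assms A by (simp add: has_density_def)
  also have "\<dots> = F (\<lambda>\<omega>. indicator A \<omega> *\<^sub>R (u - v))"
    using F_diff[OF indicator_closed[OF A] indicator_closed[OF A], of u v] by (simp add: scaleR_diff_right)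
  finally show "F (\<lambda>\<omega>. indicator A \<omega> *\<^sub>R (u - v)) = (\<integral>\<omega>\<in>A. f \<omega> - g \<omega> \<partial>M)" by simp
qed

lemma has_density_unique_AE:
  assumes "has_density v f" "has_density v g"
  shows "AE \<omega> in M. f \<omega> = g \<omega>"
  using assms by (intro density_unique_real) (auto simp: has_density_def)

text \<open>A linear lifting is not needed: countably many densities are corrected on one null set.\<close>

lemma regular_densities:
  fixes s :: "nat \<Rightarrow> 'x"
  assumes diff: "\<And>x y. x \<in> range s \<Longrightarrow> y \<in> range s \<Longrightarrow> x - y \<in> range s"
  obtains g where "\<And>v. v \<in> range s \<Longrightarrow> has_density v (g v)"
    "\<And>\<omega> x y. x \<in> range s \<Longrightarrow> y \<in> range s \<Longrightarrow> g (x - y) \<omega> = g x \<omega> - g y \<omega>"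
    "\<And>\<omega>. bdd_above (range (\<lambda>i. \<bar>g (s i) \<omega>\<bar> / norm (s i)))"
proof -
  obtain g0 where g0: "\<And>v. has_density v (g0 v)" using has_density_exists by metis
  have meas [measurable]: "g0 v \<in> borel_measurable M" for v using g0 by (auto simp: has_density_def)
  have "AE \<omega> in M. g0 (s i - s j) \<omega> = g0 (s i) \<omega> - g0 (s j) \<omega>" for i j
    by (rule has_density_unique_AE[OF g0 has_density_diff[OF g0 g0]])
  then have AE_diff: "AE \<omega> in M. \<forall>i j. g0 (s i - s j) \<omega> = g0 (s i) \<omega> - g0 (s j) \<omega>"
    by (simp add: AE_all_countable)
  define good where "good \<omega> \<longleftrightarrow> (\<forall>i j. g0 (s i - s j) \<omega> = g0 (s i) \<omega> - g0 (s j) \<omega>) \<and>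
      bdd_above (range (\<lambda>i. \<bar>g0 (s i) \<omega>\<bar> / norm (s i)))" for \<omega>
  have "AE \<omega> in M. good \<omega>"
    using AE_bdd_above_density[of s "\<lambda>i. g0 (s i)", OF g0] AE_diff
    by eventually_elim (simp add: good_def)
  then obtain N where N: "{\<omega> \<in> space M. \<not> good \<omega>} \<subseteq> N" "emeasure M N = 0" "N \<in> sets M"
    by (rule AE_E)
  have good: "good \<omega>" if "\<omega> \<in> space M - N" for \<omega> using that N(1) by blast
  \<comment> \<open>On the exceptional set, and outside \<open>space M\<close>, all densities become
    0, which is additive and bounded. The required relations then hold at every point.\<close>
  define g where "g v \<omega> = indicator (space M - N) \<omega> * g0 v \<omega>" for v \<omega>
  show ?thesis
  proof
    show "has_density v (g v)" for v
    proof (rule has_density_cong_AE[OF g0])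
      have "AE \<omega> in M. \<omega> \<notin> N" using N(2,3) by (intro AE_not_in) auto
      then show "AE \<omega> in M. g0 v \<omega> = g v \<omega>" using AE_space by eventually_elim (simp add: g_def)
      show "g v \<in> borel_measurable M" unfolding g_def using N(3) by measurable
    qed
    show "g (x - y) \<omega> = g x \<omega> - g y \<omega>" if "x \<in> range s" "y \<in> range s" for \<omega> x y
      using that good[of \<omega>] by (cases "\<omega> \<in> space M - N") (auto simp: g_def good_def)
    show "bdd_above (range (\<lambda>i. \<bar>g (s i) \<omega>\<bar> / norm (s i)))" for \<omega>
      using good[of \<omega>] by (cases "\<omega> \<in> space M - N") (simp_all add: g_def good_def)
  qed
qed

end

section \<open>Differentiability of the dual norm\<close>

lemma convex_on_powr_compose:
  fixes f :: "real \<Rightarrow> real"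
  assumes f: "convex_on UNIV f" "\<And>t. 0 \<le> f t" and q: "1 \<le> q"
  shows "convex_on UNIV (\<lambda>t. f t powr q)"
proof (rule convex_onI)
  fix t x y :: real assume t: "0 < t" "t < 1"
  have "f ((1 - t) *\<^sub>R x + t *\<^sub>R y) powr q \<le> ((1 - t) * f x + t * f y) powr q"
    using t q f(2) convex_onD[OF f(1), of t x y] by (intro powr_mono2) auto
  also have "\<dots> \<le> (1 - t) * f x powr q + t * f y powr q"
    using convex_onD[OF convex_on_powr_atLeast_0[OF q], of t "f x" "f y"] t f(2) by simp
  finally show "f ((1 - t) *\<^sub>R x + t *\<^sub>R y) powr q \<le> (1 - t) * f x powr q + t * f y powr q" .
qed simp

text \<open>Differences are adjoined repeatedly. Since 0 lies in every stage,
  \<open>x = x - 0\<close> makes the stages increase, so two elements of the union lie in a common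
  stage and their difference in the next.\<close>

lemma countable_subset_subgroup:
  fixes V :: "'x::ab_group_add set"
  assumes "countable V"
  obtains s :: "nat \<Rightarrow> 'x" where "V \<subseteq> range s" "0 \<in> range s"
    "\<And>x y. x \<in> range s \<Longrightarrow> y \<in> range s \<Longrightarrow> x - y \<in> range s"
proof -
  define S where "S n = ((\<lambda>W. (\<lambda>(x, y). x - y) ` (W \<times> W)) ^^ n) (insert 0 V)" for n
  have S_0: "S 0 = insert 0 V" and S_Suc: "S (Suc n) = (\<lambda>(x, y). x - y) ` (S n \<times> S n)" for n
    by (simp_all add: S_def)
  have zero: "0 \<in> S n" for n by (induction n) (force simp: S_0 S_Suc)+
  have "S n \<subseteq> S (Suc n)" for n using zero[of n] by (force simp: S_Suc)
  then have mono: "m \<le> n \<Longrightarrow> S m \<subseteq> S n" for m n by (rule lift_Suc_mono_le)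
  have "countable (S n)" for n by (induction n) (auto simp: S_0 S_Suc assms)
  then have "countable (\<Union>n. S n)" by simp
  moreover have "(\<Union>n. S n) \<noteq> {}" using zero by blast
  ultimately have range: "range (from_nat_into (\<Union>n. S n)) = (\<Union>n. S n)"
    by (rule range_from_nat_into[rotated])
  show ?thesis
  proof (rule that[of "from_nat_into (\<Union>n. S n)"]; unfold range)
    show "V \<subseteq> (\<Union>n. S n)" using S_0 by blast
    show "0 \<in> (\<Union>n. S n)" using zero by blast
    fix x y assume "x \<in> (\<Union>n. S n)" "y \<in> (\<Union>n. S n)"
    then obtain m n where "x \<in> S m" "y \<in> S n" by blast
    then have "x \<in> S (max m n)" "y \<in> S (max m n)"
      using mono[of m "max m n"] mono[of n "max m n"] by auto
    then have "x - y \<in> S (Suc (max m n))" by (force simp: S_Suc)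
    then show "x - y \<in> (\<Union>n. S n)" by blast
  qed
qed

section \<open>The pointwise norm on a countable subgroup\<close>

lemma dual_norm_type_space:
  fixes s :: "'k::real_normed_field \<Rightarrow> 'x::real_normed_vector \<Rightarrow> 'x"
  shows "vnorm (dual_space (type_space s)) \<phi> = (SUP x\<in>cball 0 1. norm (\<phi> x))"
proof -
  have "{x :: 'x. norm x \<le> 1} = cball 0 1" by auto
  then show ?thesis by (simp add: dual_space_def type_space_def)
qed

lemma dual_norm_second_difference:
  fixes \<phi> \<psi> :: "'x::real_normed_vector \<Rightarrow> real"
  assumes "gateaux_differentiable (dual_space (type_space (scaleR :: real \<Rightarrow> 'x \<Rightarrow> 'x)))"
    and \<phi>: "bounded_linear \<phi>" and nonzero: "\<phi> x \<noteq> 0" and \<psi>: "bounded_linear \<psi>"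
  defines "D \<equiv> \<lambda>t. SUP x\<in>cball 0 1. \<bar>\<phi> x + t * \<psi> x\<bar>"
  shows "((\<lambda>t. (D t + D (-t) - 2 * D 0) / t) \<longlongrightarrow> 0) (at_right 0)"
proof -
  let ?X = "type_space (scaleR :: real \<Rightarrow> 'x \<Rightarrow> 'x)"
  have bf: "bounded_functional ?X f" if "bounded_linear f" for f
  proof -
    from that interpret bounded_linear f .
    obtain K where "\<And>x. norm (f x) \<le> norm x * K" using bounded by blast
    then have "\<exists>K. \<forall>x. norm (f x) \<le> K * norm x" by (metis mult.commute)
    then show ?thesis
      by (simp add: bounded_functional_def type_space_def add scale del: real_norm_def)
  qed
  have "\<phi> \<noteq> vzero (dual_space ?X)"
    using nonzero by (auto simp: dual_space_def type_space_def fun_eq_iff)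
  with bf[OF \<phi>] bf[OF \<psi>] assms(1) obtain l where
    "((\<lambda>t::real. (vnorm (dual_space ?X) (vadd (dual_space ?X) \<phi> (vscale (dual_space ?X) (of_real t) \<psi>))
      - vnorm (dual_space ?X) \<phi>) / t) \<longlongrightarrow> l) (at 0)"
    unfolding gateaux_differentiable_def by (fastforce simp: dual_space_def[of ?X])
  moreover have "vadd (dual_space ?X) \<phi> (vscale (dual_space ?X) (of_real t) \<psi>) = (\<lambda>x. \<phi> x + t * \<psi> x)" for t :: real
    by (simp add: dual_space_def type_space_def fun_eq_iff)
  ultimately have "((\<lambda>t. (D t - D 0) / t) \<longlongrightarrow> l) (at 0)"
    by (simp add: dual_norm_type_space D_def)
  then show ?thesis by (rule second_difference_tendsto_0)
qed

text \<open>\<open>u\<close> and \<open>v\<close> stand for the densities of two functionals at one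
  point, known only on the subgroup \<open>range s\<close>. If \<open>u\<close> is not zero there,
  both are extended to X and \<open>n\<close> is squeezed between its own convexity and the
  differentiable norm of the extension. If \<open>u\<close> is zero there, the power
  \<open>q > 1\<close> provides the smoothness.\<close>

lemma SUP_second_difference:
  fixes s :: "nat \<Rightarrow> 'x::real_normed_vector" and u v :: "'x \<Rightarrow> real"
  assumes diff: "gateaux_differentiable (dual_space (type_space (scaleR :: real \<Rightarrow> 'x \<Rightarrow> 'x)))"
    and s: "0 \<in> range s" "\<And>x y. x \<in> range s \<Longrightarrow> y \<in> range s \<Longrightarrow> x - y \<in> range s"
    and u: "\<And>x y. x \<in> range s \<Longrightarrow> y \<in> range s \<Longrightarrow> u (x - y) = u x - u y"
      "bdd_above (range (\<lambda>i. \<bar>u (s i)\<bar> / norm (s i)))"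
    and v: "\<And>x y. x \<in> range s \<Longrightarrow> y \<in> range s \<Longrightarrow> v (x - y) = v x - v y"
      "bdd_above (range (\<lambda>i. \<bar>v (s i)\<bar> / norm (s i)))"
    and q: "1 < q"
  defines "n \<equiv> \<lambda>t. SUP i. \<bar>u (s i) + t * v (s i)\<bar> / norm (s i)"
  shows "\<And>t. bdd_above (range (\<lambda>i. \<bar>u (s i) + t * v (s i)\<bar> / norm (s i)))"
    and "convex_on UNIV (\<lambda>t. n t powr q)"
    and "((\<lambda>t. (n t powr q + n (-t) powr q - 2 * n 0 powr q) / t) \<longlongrightarrow> 0) (at_right 0)"
proof -
  define K where "K = (SUP i. \<bar>u (s i)\<bar> / norm (s i))"
  define L where "L = (SUP i. \<bar>v (s i)\<bar> / norm (s i))"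
  have K: "\<bar>u (s i)\<bar> / norm (s i) \<le> K" and L: "\<bar>v (s i)\<bar> / norm (s i) \<le> L" for i
    unfolding K_def L_def by (intro cSUP_upper u(2) v(2); simp)+
  have K_nonneg: "0 \<le> K" and L_nonneg: "0 \<le> L"
    using order_trans[OF _ K[of 0]] order_trans[OF _ L[of 0]] by auto
  have scaled: "\<bar>u (s i) + t * v (s i)\<bar> / norm (s i) = \<bar>u (s i) / norm (s i) + t * (v (s i) / norm (s i))\<bar>" for i t
    by (simp add: add_divide_distrib[symmetric])
  have K': "\<bar>u (s i) / norm (s i)\<bar> \<le> K" and L': "\<bar>v (s i) / norm (s i)\<bar> \<le> L" for i
    using K L by simp_all
  show bdd: "bdd_above (range (\<lambda>i. \<bar>u (s i) + t * v (s i)\<bar> / norm (s i)))" for t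
    unfolding scaled using K' L' by (intro convex_on_SUP_abs(1)) auto
  have n_convex: "convex_on UNIV n"
    unfolding n_def scaled using K' L' by (intro convex_on_SUP_abs(2)) auto
  have n_ge: "\<bar>u (s i) + t * v (s i)\<bar> / norm (s i) \<le> n t" for i t
    unfolding n_def by (intro cSUP_upper bdd) simp
  have n_nonneg: "0 \<le> n t" for t by (rule order_trans[OF _ n_ge[of 0]]) simp
  have n_0: "n 0 = K" by (simp add: n_def K_def)
  show "convex_on UNIV (\<lambda>t. n t powr q)"
    using n_convex n_nonneg q by (intro convex_on_powr_compose) auto
  \<comment> \<open>At 0 the quotient bound carries no information, since division by 0 yields 0;
    there additivity gives \<open>u 0 = 0\<close>.\<close>
  have u_le: "\<bar>u x\<bar> \<le> K * norm x" if "x \<in> range s" for x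
  proof (cases "x = 0")
    case True
    then show ?thesis using u(1)[OF s(1) s(1)] by simp
  next
    case False
    from that obtain i where "x = s i" by blast
    then show ?thesis using False K[of i] by (simp add: pos_divide_le_eq)
  qed
  have v_le: "\<bar>v x\<bar> \<le> L * norm x" if "x \<in> range s" for x
  proof (cases "x = 0")
    case True
    then show ?thesis using v(1)[OF s(1) s(1)] by simp
  next
    case False
    from that obtain i where "x = s i" by blast
    then show ?thesis using False L[of i] by (simp add: pos_divide_le_eq)
  qed
  show "((\<lambda>t. (n t powr q + n (-t) powr q - 2 * n 0 powr q) / t) \<longlongrightarrow> 0) (at_right 0)"
  proof (cases "K = 0")
    case True
    \<comment> \<open>With \<open>u\<close> zero on the subgroup, \<open>n t powr q\<close> is of
      order \<open>t powr q\<close>, which is o(t) because \<open>q > 1\<close>.\<close>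
    have n_le: "n t \<le> \<bar>t\<bar> * L" for t
      unfolding n_def
    proof (rule cSUP_least)
      fix i
      have "\<bar>u (s i) + t * v (s i)\<bar> / norm (s i) = \<bar>t\<bar> * (\<bar>v (s i)\<bar> / norm (s i))"
        using u_le[of "s i"] True by (simp add: abs_mult)
      also have "\<dots> \<le> \<bar>t\<bar> * L" by (intro mult_left_mono L) simp
      finally show "\<bar>u (s i) + t * v (s i)\<bar> / norm (s i) \<le> \<bar>t\<bar> * L" .
    qed simp
    have "((\<lambda>t. 2 * (t powr (q - 1) * L powr q)) \<longlongrightarrow> 0) (at_right 0)"
      using q by (auto intro!: tendsto_eq_intros tendsto_ident_at simp: eventually_at_filter)
    moreover have "\<forall>\<^sub>F t in at_right 0. norm ((n t powr q + n (-t) powr q - 2 * n 0 powr q) / t) \<le> 2 * (t powr (q - 1) * L powr q)"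
      unfolding eventually_at_filter
    proof (intro always_eventually allI impI)
      fix t :: real assume "t \<in> {0<..}"
      then have t: "0 < t" by simp
      have "n t powr q \<le> (t * L) powr q" "n (-t) powr q \<le> (t * L) powr q"
        using n_le[of t] n_le[of "-t"] n_nonneg t q by (auto intro!: powr_mono2)
      then have "(n t powr q + n (-t) powr q) / t \<le> 2 * (t * L) powr q / t"
        using t by (intro divide_right_mono) auto
      also have "(t * L) powr q = t * (t powr (q - 1) * L powr q)"
        using t L_nonneg by (simp add: powr_mult powr_diff)
      finally show "norm ((n t powr q + n (-t) powr q - 2 * n 0 powr q) / t) \<le> 2 * (t powr (q - 1) * L powr q)"
        using t True n_0 by simp
    qed
    ultimately show ?thesis by (rule Lim_null_comparison[rotated])
  next
    case False
    then have K_pos: "0 < K" using K_nonneg by simp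
    obtain \<phi> where \<phi>: "bounded_linear \<phi>" "\<And>x. x \<in> range s \<Longrightarrow> \<phi> x = u x" "\<And>x. \<bar>\<phi> x\<bar> \<le> K * norm x"
      using hahn_banach_subgroup[of "range s" u K] s u(1) u_le K_nonneg by blast
    obtain \<psi> where \<psi>: "bounded_linear \<psi>" "\<And>x. x \<in> range s \<Longrightarrow> \<psi> x = v x" "\<And>x. \<bar>\<psi> x\<bar> \<le> L * norm x"
      using hahn_banach_subgroup[of "range s" v L] s v(1) v_le L_nonneg by blast
    interpret \<phi>: bounded_linear \<phi> by fact
    interpret \<psi>: bounded_linear \<psi> by fact
    define D where "D t = (SUP x\<in>cball 0 1. \<bar>\<phi> x + t * \<psi> x\<bar>)" for t
    have "\<bar>\<phi> x\<bar> \<le> K" "\<bar>\<psi> x\<bar> \<le> L" if "x \<in> cball 0 1" for x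
      using \<phi>(3)[of x] \<psi>(3)[of x] that mult_left_mono[of "norm x" 1 K] mult_left_mono[of "norm x" 1 L]
        K_nonneg L_nonneg by auto
    then have D_bdd: "bdd_above ((\<lambda>x. \<bar>\<phi> x + t * \<psi> x\<bar>) ` cball 0 1)" for t
      by (intro convex_on_SUP_abs(1)) auto
    \<comment> \<open>Only normalised elements of the subgroup enter \<open>n\<close>, so away from
      0 it may lie strictly below the norm of the extension. For \<open>s i = 0\<close> both sides
      of the equation in the proof are 0.\<close>
    have n_le_D: "n t \<le> D t" for t
      unfolding n_def
    proof (rule cSUP_least)
      fix i
      have "\<bar>u (s i) + t * v (s i)\<bar> / norm (s i) = \<bar>\<phi> (s i /\<^sub>R norm (s i)) + t * \<psi> (s i /\<^sub>R norm (s i))\<bar>"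
        unfolding scaled by (simp add: \<phi>.scaleR \<psi>.scaleR \<phi>(2) \<psi>(2) divide_inverse mult.commute[of "inverse _"])
      also have "\<dots> \<le> D t"
        unfolding D_def by (intro cSUP_upper D_bdd) (simp add: field_simps)
      finally show "\<bar>u (s i) + t * v (s i)\<bar> / norm (s i) \<le> D t" .
    qed simp
    \<comment> \<open>This is where it matters that the extension of \<open>u\<close> has the same
      bound \<open>K\<close>: equality at 0 makes the second differences of \<open>n\<close> at most
      those of \<open>D\<close>.\<close>
    have D_0: "D 0 = n 0"
    proof (rule antisym)
      show "D 0 \<le> n 0"
        unfolding D_def n_0
      proof (rule cSUP_least)
        fix x :: 'x assume "x \<in> cball 0 1"
        then show "\<bar>\<phi> x + 0 * \<psi> x\<bar> \<le> K"
          using \<phi>(3)[of x] mult_left_mono[of "norm x" 1 K] K_nonneg by auto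
      qed simp
    qed (rule n_le_D)
    obtain x where "\<phi> x \<noteq> 0"
    proof -
      have "\<exists>i. u (s i) \<noteq> 0"
        using K_pos by (rule contrapos_pp) (simp add: K_def)
      then show ?thesis using that \<phi>(2) by fastforce
    qed
    from dual_norm_second_difference[OF diff \<phi>(1) this \<psi>(1)]
    have "((\<lambda>t. (D t + D (-t) - 2 * D 0) / t) \<longlongrightarrow> 0) (at_right 0)" by (simp add: D_def)
    then have "((\<lambda>t. (n t + n (-t) - 2 * n 0) / t) \<longlongrightarrow> 0) (at_right 0)"
    proof (rule tendsto_sandwich[rotated -1, OF _ _ _ tendsto_const], goal_cases)
      case 1
      show ?case
        using convex_on_second_difference_nonneg[OF n_convex]
        by (auto simp: eventually_at_filter)
    next
      case 2
      have "n t + n (-t) - 2 * n 0 \<le> D t + D (-t) - 2 * D 0" for t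
        using n_le_D[of t] n_le_D[of "-t"] D_0 by simp
      then show ?case by (auto simp: eventually_at_filter divide_right_mono)
    qed
    \<comment> \<open>The chain rule for the power needs a derivative of \<open>n\<close> itself,
      and \<open>n 0 > 0\<close>, which is the case assumption on \<open>K\<close>.\<close>
    from convex_on_differentiable_at_0[OF n_convex this]
    obtain l where "((\<lambda>t. (n t - n 0) / t) \<longlongrightarrow> l) (at 0)" by blast
    then have "(n has_field_derivative l) (at 0)" by (simp add: DERIV_def)
    then have "((\<lambda>t. n t powr q) has_field_derivative (q * n 0 powr (q - of_nat 1) * l)) (at 0)"
      by (rule DERIV_fun_powr) (simp add: n_0 K_pos)
    then have "((\<lambda>t. (n t powr q - n 0 powr q) / t) \<longlongrightarrow> q * n 0 powr (q - of_nat 1) * l) (at 0)"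
      by (simp add: DERIV_def)
    then show ?thesis by (rule second_difference_tendsto_0)
  qed
qed

section \<open>Norms of functionals, and Young's bound by simple approximation\<close>

lemma Lp_norm_nonneg: "0 \<le> Lp_norm M p f"
  by (simp add: Lp_norm_def)

lemma Lp_norm_scaleR:
  assumes "0 < p"
  shows "Lp_norm M p (\<lambda>\<omega>. r *\<^sub>R f \<omega>) = \<bar>r\<bar> * Lp_norm M p f"
  using assms by (simp add: Lp_norm_def powr_mult powr_powr)

definition Lp_unit_ball :: "'a measure \<Rightarrow> real \<Rightarrow> ('a \<Rightarrow> 'x::real_normed_vector) set" where
  "Lp_unit_ball M p = {f \<in> Lp_fun M p. Lp_norm M p f \<le> 1}"

lemma Lp_unit_ball_integral_le:
  assumes "f \<in> Lp_unit_ball M p" "0 < p"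
  shows "(\<integral>\<omega>. norm (f \<omega>) powr p \<partial>M) \<le> 1"
proof -
  let ?J = "\<integral>\<omega>. norm (f \<omega>) powr p \<partial>M"
  have "0 \<le> ?J" by (intro Bochner_Integration.integral_nonneg) simp
  have "?J powr (1 / p) \<le> 1" using assms(1) by (simp add: Lp_unit_ball_def Lp_norm_def)
  then have "(?J powr (1 / p)) powr p \<le> 1 powr p" using assms(2) by (intro powr_mono2) auto
  then show ?thesis using \<open>0 \<le> ?J\<close> assms(2) by (simp add: powr_powr)
qed

lemma Lp_functional_combination:
  fixes F G :: "('a \<Rightarrow> 'x::real_normed_vector) \<Rightarrow> real"
  assumes "Lp_functional M p q C F" "Lp_functional M p q D G"
  shows "Lp_functional M p q (C + \<bar>t\<bar> * D) (\<lambda>f. F f + t * G f)"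
proof -
  interpret F: Lp_functional M p q C F by fact
  interpret G: Lp_functional M p q D G by fact
  show ?thesis
  proof
    show "1 < p" "1 / p + 1 / q = 1" "0 \<le> C + \<bar>t\<bar> * D"
      using F.p F.pq F.C_nonneg G.C_nonneg by auto
    fix f :: "'a \<Rightarrow> 'x" assume f: "f \<in> Lp_fun M p"
    show "F (\<lambda>\<omega>. f \<omega> + g \<omega>) + t * G (\<lambda>\<omega>. f \<omega> + g \<omega>) = F f + t * G f + (F g + t * G g)"
      if "g \<in> Lp_fun M p" for g
      using f that by (simp add: F.add G.add algebra_simps)
    show "F (\<lambda>\<omega>. r *\<^sub>R f \<omega>) + t * G (\<lambda>\<omega>. r *\<^sub>R f \<omega>) = r * (F f + t * G f)" for r
      using f by (simp add: F.scale G.scale algebra_simps)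
    have "\<bar>F f + t * G f\<bar> \<le> \<bar>F f\<bar> + \<bar>t\<bar> * \<bar>G f\<bar>"
      using abs_triangle_ineq[of "F f" "t * G f"] by (simp add: abs_mult)
    also have "\<dots> \<le> C * Lp_norm M p f + \<bar>t\<bar> * (D * Lp_norm M p f)"
      using f by (intro add_mono mult_left_mono F.bound G.bound) auto
    finally show "\<bar>F f + t * G f\<bar> \<le> (C + \<bar>t\<bar> * D) * Lp_norm M p f"
      by (simp add: algebra_simps)
  qed
qed

context Lp_functional
begin

lemma unit_ball_nonempty: "Lp_unit_ball M p \<noteq> {}"
  using Lp_fun_zero[of M p] p by (auto simp: Lp_unit_ball_def Lp_norm_def)

lemma abs_le_if_unit_ball: "f \<in> Lp_unit_ball M p \<Longrightarrow> \<bar>F f\<bar> \<le> C"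
  using bound[of f] C_nonneg mult_left_mono[of "Lp_norm M p f" 1 C] by (auto simp: Lp_unit_ball_def)

lemma bdd_above_unit_ball: "bdd_above ((\<lambda>f. \<bar>F f\<bar>) ` Lp_unit_ball M p)"
  using abs_le_if_unit_ball by (rule bdd_aboveI2)

text \<open>The bound on the integral of the density norm must be sharp at \<open>t = 0\<close>, so
  an arbitrary bound \<open>C\<close> is exchanged for the norm of the functional.\<close>

lemma Lp_functional_SUP: "Lp_functional M p q (SUP f\<in>Lp_unit_ball M p. \<bar>F f\<bar>) F"
proof
  let ?N = "SUP f\<in>Lp_unit_ball M p. \<bar>F f\<bar>"
  show "0 \<le> ?N"
  proof -
    obtain f :: "'a \<Rightarrow> 'x" where f: "f \<in> Lp_unit_ball M p" using unit_ball_nonempty by blast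
    show ?thesis by (rule cSUP_upper2[OF bdd_above_unit_ball f]) simp
  qed
  fix f :: "'a \<Rightarrow> 'x" assume f: "f \<in> Lp_fun M p"
  show "\<bar>F f\<bar> \<le> ?N * Lp_norm M p f"
  proof (cases "Lp_norm M p f = 0")
    case True
    then show ?thesis using bound[OF f] by simp
  next
    case False
    then have pos: "0 < Lp_norm M p f" using Lp_norm_nonneg[of M p f] by simp
    have "(\<lambda>\<omega>. (1 / Lp_norm M p f) *\<^sub>R f \<omega>) \<in> Lp_unit_ball M p"
      unfolding Lp_unit_ball_def using scale_closed[OF f] Lp_norm_scaleR[of p M "1 / Lp_norm M p f" f] p pos
      by simp
    then have "\<bar>F (\<lambda>\<omega>. (1 / Lp_norm M p f) *\<^sub>R f \<omega>)\<bar> \<le> ?N"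
      by (intro cSUP_upper bdd_above_unit_ball)
    then have "\<bar>F f\<bar> / Lp_norm M p f \<le> ?N" using scale[OF f] pos by simp
    then show ?thesis using pos by (simp add: pos_divide_le_eq)
  qed
qed (use p pq add scale in auto)

text \<open>Convergence of the integrals of the p-th powers is recorded besides convergence in norm,
  because Young's inequality bounds the functional in terms of that integral.\<close>

lemma simple_approximation:
  assumes f: "f \<in> Lp_fun M p"
  obtains s where "\<And>i. simple_function M (s i)"
    "(\<lambda>i. Lp_norm M p (\<lambda>\<omega>. s i \<omega> - f \<omega>)) \<longlonglongrightarrow> 0"
    "(\<lambda>i. \<integral>\<omega>. norm (s i \<omega>) powr p \<partial>M) \<longlonglongrightarrow> (\<integral>\<omega>. norm ((f :: 'a \<Rightarrow> 'x) \<omega>) powr p \<partial>M)"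
proof -
  have f_meas [measurable]: "(\<lambda>\<omega>. norm (f \<omega>)) \<in> borel_measurable M"
    using f by (auto simp: Lp_fun_def intro: strongly_measurable_norm)
  have f_int: "integrable M (\<lambda>\<omega>. norm (f \<omega>) powr p)" using f by (simp add: Lp_fun_def)
  obtain r where r: "\<And>i. simple_function M (r i)" "\<And>\<omega>. \<omega> \<in> space M \<Longrightarrow> (\<lambda>i. r i \<omega>) \<longlonglongrightarrow> f \<omega>"
    using f unfolding Lp_fun_def strongly_measurable_def by blast
  have r_meas [measurable]: "(\<lambda>\<omega>. norm (r i \<omega>)) \<in> borel_measurable M" for i
    by (intro strongly_measurable_norm strongly_measurable_simple r(1))
  \<comment> \<open>Truncation: \<open>r i\<close> is kept only where its norm is at most twice that
    of \<open>f\<close>. This yields a dominating function, and where \<open>f\<close> is not 0 it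
    eventually changes nothing, since the norms converge to that of \<open>f\<close>.\<close>
  define A where "A i = {\<omega> \<in> space M. norm (r i \<omega>) \<le> 2 * norm (f \<omega>)}" for i
  have A: "A i \<in> sets M" for i unfolding A_def by measurable
  define s where "s i \<omega> = (indicator (A i) \<omega> :: real) *\<^sub>R r i \<omega>" for i \<omega>
  have s_simple: "simple_function M (s i)" for i
    unfolding s_def by (rule simple_function_compose2[OF simple_function_indicator[OF A] r(1)])
  have s_closed: "s i \<in> Lp_fun M p" for i by (rule Lp_fun_simple[OF s_simple])
  have s_le: "norm (s i \<omega>) \<le> 2 * norm (f \<omega>)" for i \<omega>
    by (cases "\<omega> \<in> A i") (auto simp: s_def A_def)
  have s_lim: "(\<lambda>i. s i \<omega>) \<longlonglongrightarrow> f \<omega>" if \<omega>: "\<omega> \<in> space M" for \<omega>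
  proof (cases "f \<omega> = 0")
    case True
    then show ?thesis using s_le[of _ \<omega>] by simp
  next
    case False
    have "(\<lambda>i. norm (r i \<omega>)) \<longlonglongrightarrow> norm (f \<omega>)" by (intro tendsto_norm r(2) \<omega>)
    then have "\<forall>\<^sub>F i in sequentially. norm (r i \<omega>) < 2 * norm (f \<omega>)"
      using False by (intro order_tendstoD(2)) auto
    then have "\<forall>\<^sub>F i in sequentially. r i \<omega> = s i \<omega>"
      by eventually_elim (use \<omega> in \<open>simp add: s_def A_def\<close>)
    with r(2)[OF \<omega>] show ?thesis by (rule Lim_transform_eventually)
  qed
  have diff_int: "integrable M (\<lambda>\<omega>. norm (s i \<omega> - f \<omega>) powr p)" for i
    using diff_closed[OF s_closed f] by (simp add: Lp_fun_def)
  have s_int: "integrable M (\<lambda>\<omega>. norm (s i \<omega>) powr p)" for i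
    using s_closed by (simp add: Lp_fun_def)
  have "(\<lambda>i. \<integral>\<omega>. norm (s i \<omega> - f \<omega>) powr p \<partial>M) \<longlonglongrightarrow> (\<integral>\<omega>. 0 \<partial>M)"
  proof (rule integral_dominated_convergence)
    show "integrable M (\<lambda>\<omega>. 3 powr p * norm (f \<omega>) powr p)" using f_int by simp
    show "AE \<omega> in M. (\<lambda>i. norm (s i \<omega> - f \<omega>) powr p) \<longlonglongrightarrow> 0"
    proof (rule AE_I2)
      fix \<omega> assume "\<omega> \<in> space M"
      then have "(\<lambda>i. s i \<omega> - f \<omega>) \<longlonglongrightarrow> 0" using s_lim by (simp add: LIM_zero)
      then have "(\<lambda>i. norm (s i \<omega> - f \<omega>)) \<longlonglongrightarrow> 0" by (rule tendsto_norm_zero)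
      then show "(\<lambda>i. norm (s i \<omega> - f \<omega>) powr p) \<longlonglongrightarrow> 0"
        using p by (intro tendsto_zero_powrI[OF _ tendsto_const]) auto
    qed
    show "AE \<omega> in M. norm (norm (s i \<omega> - f \<omega>) powr p) \<le> 3 powr p * norm (f \<omega>) powr p" for i
    proof (rule AE_I2)
      fix \<omega>
      have "norm (s i \<omega> - f \<omega>) \<le> 3 * norm (f \<omega>)"
        using norm_triangle_ineq4[of "s i \<omega>" "f \<omega>"] s_le[of i \<omega>] by simp
      then have "norm (s i \<omega> - f \<omega>) powr p \<le> (3 * norm (f \<omega>)) powr p"
        using p by (intro powr_mono2) auto
      then show "norm (norm (s i \<omega> - f \<omega>) powr p) \<le> 3 powr p * norm (f \<omega>) powr p"
        by (simp add: powr_mult)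
    qed
  qed (use diff_int in \<open>auto dest: borel_measurable_integrable\<close>)
  then have "(\<lambda>i. Lp_norm M p (\<lambda>\<omega>. s i \<omega> - f \<omega>)) \<longlonglongrightarrow> 0"
    unfolding Lp_norm_def using p by (auto intro!: tendsto_eq_intros)
  moreover have "(\<lambda>i. \<integral>\<omega>. norm (s i \<omega>) powr p \<partial>M) \<longlonglongrightarrow> (\<integral>\<omega>. norm (f \<omega>) powr p \<partial>M)"
  proof (rule integral_dominated_convergence)
    show "integrable M (\<lambda>\<omega>. 2 powr p * norm (f \<omega>) powr p)" using f_int by simp
    show "AE \<omega> in M. (\<lambda>i. norm (s i \<omega>) powr p) \<longlonglongrightarrow> norm (f \<omega>) powr p"
    proof (rule AE_I2)
      fix \<omega> assume "\<omega> \<in> space M"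
      then have "(\<lambda>i. norm (s i \<omega>)) \<longlonglongrightarrow> norm (f \<omega>)" by (intro tendsto_norm s_lim)
      then show "(\<lambda>i. norm (s i \<omega>) powr p) \<longlonglongrightarrow> norm (f \<omega>) powr p"
        using p by (intro tendsto_powr') auto
    qed
    show "AE \<omega> in M. norm (norm (s i \<omega>) powr p) \<le> 2 powr p * norm (f \<omega>) powr p" for i
    proof (rule AE_I2)
      fix \<omega>
      have "norm (s i \<omega>) powr p \<le> (2 * norm (f \<omega>)) powr p"
        using p s_le by (intro powr_mono2) auto
      then show "norm (norm (s i \<omega>) powr p) \<le> 2 powr p * norm (f \<omega>) powr p"
        by (simp add: powr_mult)
    qed
  qed (use s_int f_int in \<open>auto dest: borel_measurable_integrable\<close>)
  ultimately show ?thesis using that[of s] s_simple by simp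
qed

lemma F_tendsto:
  assumes "\<And>i. s i \<in> Lp_fun M p" "f \<in> Lp_fun M p" "(\<lambda>i. Lp_norm M p (\<lambda>\<omega>. s i \<omega> - f \<omega>)) \<longlonglongrightarrow> 0"
  shows "(\<lambda>i. F (s i)) \<longlonglongrightarrow> F f"
proof -
  have "(\<lambda>i. C * Lp_norm M p (\<lambda>\<omega>. s i \<omega> - f \<omega>)) \<longlonglongrightarrow> 0"
    using tendsto_mult_right_zero[OF assms(3)] .
  moreover have "norm (F (s i) - F f) \<le> C * Lp_norm M p (\<lambda>\<omega>. s i \<omega> - f \<omega>)" for i
    using bound[OF diff_closed[OF assms(1,2)]] F_diff[OF assms(1,2)] by simp
  ultimately have "(\<lambda>i. F (s i) - F f) \<longlonglongrightarrow> 0"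
    by (rule Lim_null_comparison[OF always_eventually[OF allI], rotated])
  then show ?thesis by (rule LIM_zero_cancel)
qed

text \<open>Young's inequality is used instead of the Hoelder inequality: for \<open>R = \<parallel>F\<parallel>\<close> the bound is tangent to
  \<open>I \<mapsto> I powr (1 / q)\<close> at \<open>I = R powr q\<close>, which is all that differentiation at \<open>0\<close> sees.\<close>

lemma abs_simple_le:
  fixes s :: "nat \<Rightarrow> 'x" and g :: "'x \<Rightarrow> 'a \<Rightarrow> real"
  assumes g: "\<And>v. v \<in> range s \<Longrightarrow> has_density v (g v)" and g_0: "\<And>\<omega>. g 0 \<omega> = 0"
    and bdd: "\<And>\<omega>. bdd_above (range (\<lambda>i. \<bar>g (s i) \<omega>\<bar> / norm (s i)))"
    and y: "simple_function M y" "y ` space M \<subseteq> range s" and R: "0 < R"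
  shows "\<bar>F y\<bar> \<le> R powr (1 - q) / q * (\<integral>\<omega>. (SUP i. \<bar>g (s i) \<omega>\<bar> / norm (s i)) powr q \<partial>M)
    + R / p * (\<integral>\<omega>. norm (y \<omega>) powr p \<partial>M)"
proof -
  define n where "n \<omega> = (SUP i. \<bar>g (s i) \<omega>\<bar> / norm (s i))" for \<omega>
  have n_ge: "\<bar>g (s i) \<omega>\<bar> / norm (s i) \<le> n \<omega>" for i \<omega>
    unfolding n_def by (intro cSUP_upper bdd) simp
  have n_nonneg: "0 \<le> n \<omega>" for \<omega> by (rule order_trans[OF _ n_ge[of 0]]) simp
  have n_int: "integrable M (\<lambda>\<omega>. n \<omega> powr q)"
    unfolding n_def using g bdd by (intro integral_SUP_density_le) auto
  have y_int: "integrable M (\<lambda>\<omega>. norm (y \<omega>) powr p)"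
    using Lp_fun_simple[OF y(1)] by (simp add: Lp_fun_def)
  have dens: "integrable M (\<lambda>\<omega>. g (y \<omega>) \<omega>)" "F y = (\<integral>\<omega>. g (y \<omega>) \<omega> \<partial>M)"
    using F_simple[OF y(1), of g] g y(2) by blast+
  have le: "\<bar>g (y \<omega>) \<omega>\<bar> \<le> R powr (1 - q) / q * n \<omega> powr q + R / p * norm (y \<omega>) powr p"
    if \<omega>: "\<omega> \<in> space M" for \<omega>
  proof -
    obtain i where i: "y \<omega> = s i" using y(2) \<omega> by blast
    have "\<bar>g (y \<omega>) \<omega>\<bar> \<le> n \<omega> * norm (y \<omega>)"
    proof (cases "y \<omega> = 0")
      case True
      then show ?thesis by (simp add: g_0)
    next
      case False
      then show ?thesis using n_ge[of i \<omega>] by (simp add: i pos_divide_le_eq)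
    qed
    \<comment> \<open>Factoring out \<open>R\<close> means that Young's inequality is applied to
      \<open>norm (y \<omega>)\<close> and \<open>n \<omega> / R\<close>; it is an equality when
      both are 1.\<close>
    also have "\<dots> = R * (norm (y \<omega>) * (n \<omega> / R))" using R by simp
    also have "\<dots> \<le> R * (norm (y \<omega>) powr p / p + (n \<omega> / R) powr q / q)"
      using R n_nonneg by (intro mult_left_mono Youngs_inequality p q pq) auto
    also have "\<dots> = R powr (1 - q) / q * n \<omega> powr q + R / p * norm (y \<omega>) powr p"
      using R n_nonneg by (simp add: powr_divide powr_diff algebra_simps)
    finally show ?thesis .
  qed
  have "\<bar>F y\<bar> \<le> (\<integral>\<omega>. \<bar>g (y \<omega>) \<omega>\<bar> \<partial>M)" unfolding dens(2) by (rule integral_abs_bound)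
  also have "\<dots> \<le> (\<integral>\<omega>. R powr (1 - q) / q * n \<omega> powr q + R / p * norm (y \<omega>) powr p \<partial>M)"
    using dens(1) n_int y_int le by (intro integral_mono) auto
  also have "\<dots> = R powr (1 - q) / q * (\<integral>\<omega>. n \<omega> powr q \<partial>M) + R / p * (\<integral>\<omega>. norm (y \<omega>) powr p \<partial>M)"
    using n_int y_int by simp
  finally show ?thesis by (simp add: n_def)
qed

lemma abs_le_if_approximable:
  fixes s :: "nat \<Rightarrow> 'x" and g :: "'x \<Rightarrow> 'a \<Rightarrow> real"
  assumes g: "\<And>v. v \<in> range s \<Longrightarrow> has_density v (g v)" "\<And>\<omega>. g 0 \<omega> = 0"
    "\<And>\<omega>. bdd_above (range (\<lambda>i. \<bar>g (s i) \<omega>\<bar> / norm (s i)))"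
    and R: "0 < R" and x: "x \<in> Lp_unit_ball M p"
    and y: "\<And>j. simple_function M (y j)" "\<And>j. y j ` space M \<subseteq> range s"
      "(\<lambda>j. Lp_norm M p (\<lambda>\<omega>. y j \<omega> - x \<omega>)) \<longlonglongrightarrow> 0"
      "(\<lambda>j. \<integral>\<omega>. norm (y j \<omega>) powr p \<partial>M) \<longlonglongrightarrow> (\<integral>\<omega>. norm (x \<omega>) powr p \<partial>M)"
  shows "\<bar>F x\<bar> \<le> R powr (1 - q) / q * (\<integral>\<omega>. (SUP i. \<bar>g (s i) \<omega>\<bar> / norm (s i)) powr q \<partial>M) + R / p"
proof -
  let ?I = "\<integral>\<omega>. (SUP i. \<bar>g (s i) \<omega>\<bar> / norm (s i)) powr q \<partial>M"
  have x': "x \<in> Lp_fun M p" using x by (simp add: Lp_unit_ball_def)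
  have "(\<lambda>j. \<bar>F (y j)\<bar>) \<longlonglongrightarrow> \<bar>F x\<bar>"
    by (intro tendsto_rabs F_tendsto Lp_fun_simple x' y)
  moreover have "(\<lambda>j. R powr (1 - q) / q * ?I + R / p * (\<integral>\<omega>. norm (y j \<omega>) powr p \<partial>M))
      \<longlonglongrightarrow> R powr (1 - q) / q * ?I + R / p * (\<integral>\<omega>. norm (x \<omega>) powr p \<partial>M)"
    by (intro tendsto_intros y(4))
  ultimately have "\<bar>F x\<bar> \<le> R powr (1 - q) / q * ?I + R / p * (\<integral>\<omega>. norm (x \<omega>) powr p \<partial>M)"
    by (rule LIMSEQ_le) (use abs_simple_le[OF g y(1,2) R] in blast)
  also have "\<dots> \<le> R powr (1 - q) / q * ?I + R / p * 1"
    using R p by (intro add_left_mono mult_left_mono Lp_unit_ball_integral_le x) auto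
  finally show ?thesis by simp
qed

end

text \<open>\<open>N\<close> is compared with \<open>a * I t + R / p\<close>, where
  \<open>I t\<close> integrates the q-th power of the pointwise norm. At 0 this is at most
  \<open>N 0\<close>, and along the chosen sequence it bounds \<open>N\<close> from above up to
  \<open>e i\<close>. The constant \<open>a\<close> is a power of \<open>N 0\<close>, hence the
  positivity assumption.\<close>

lemma Lp_norm_second_difference:
  fixes F G :: "('a \<Rightarrow> 'x::real_normed_vector) \<Rightarrow> real"
  assumes diff: "gateaux_differentiable (dual_space (type_space (scaleR :: real \<Rightarrow> 'x \<Rightarrow> 'x)))"
    and F: "Lp_functional M p q C F" and G: "Lp_functional M p q D G"
  defines "N \<equiv> \<lambda>t. SUP f\<in>Lp_unit_ball M p. \<bar>F f + t * G f\<bar>"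
  assumes pos: "0 < N 0"
  shows "convex_on UNIV N"
    and "((\<lambda>t. (N t + N (-t) - 2 * N 0) / t) \<longlongrightarrow> 0) (at_right 0)"
proof -
  interpret F: Lp_functional M p q C F by (rule F)
  interpret G: Lp_functional M p q D G by (rule G)
  interpret FG: Lp_functional M p q "C + \<bar>t\<bar> * D" "\<lambda>f. F f + t * G f" for t
    by (rule Lp_functional_combination[OF F G])
  interpret N: Lp_functional M p q "N t" "\<lambda>f. F f + t * G f" for t
    unfolding N_def by (rule FG.Lp_functional_SUP)
  show N_convex: "convex_on UNIV N"
    unfolding N_def
    by (rule convex_on_SUP_abs(2)[OF F.unit_ball_nonempty F.abs_le_if_unit_ball G.abs_le_if_unit_ball])
  define R where "R = N 0"
  have R: "0 < R" using pos by (simp add: R_def)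
  have q: "1 < q" by (rule F.q)
  have maximiser: "\<exists>f\<in>Lp_unit_ball M p. N t - e < \<bar>F f + t * G f\<bar>" if "0 < e" for t e
  proof -
    have "N t - e < (SUP f\<in>Lp_unit_ball M p. \<bar>F f + t * G f\<bar>)" using that by (simp add: N_def)
    then show ?thesis
      by (rule less_cSUP_iff[OF F.unit_ball_nonempty FG.bdd_above_unit_ball, THEN iffD1])
  qed
  show "((\<lambda>t. (N t + N (-t) - 2 * N 0) / t) \<longlongrightarrow> 0) (at_right 0)"
    \<comment> \<open>The right-sided limit is taken within \<open>{0..1}\<close> to have
      \<open>T i \<le> 1\<close>, as domination by the values at 1 and -1 requires.\<close>
    unfolding at_within_Icc_at_right[OF zero_less_one, symmetric] tendsto_at_iff_sequentially
  proof (intro allI impI, unfold comp_def)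
    fix T :: "nat \<Rightarrow> real" assume "\<forall>i. T i \<in> {0..1} - {0}" and T_lim: "T \<longlonglongrightarrow> 0"
    then have T: "0 < T i" "T i \<le> 1" for i by (auto simp: less_le)
    \<comment> \<open>The error of the near-maximisers must be of smaller order than
      \<open>T i\<close>; divided by \<open>T i\<close> it leaves
      \<open>1 / real (Suc i)\<close>.\<close>
    define e where "e i = T i / real (Suc i)" for i
    have e: "0 < e i" for i using T(1)[of i] by (simp add: e_def)
    have "\<exists>f\<in>Lp_unit_ball M p. N (T i) - e i < \<bar>F f + (T i) * G f\<bar>" for i by (rule maximiser[OF e])
    then obtain x where x: "\<And>i. x i \<in> Lp_unit_ball M p" "\<And>i. N (T i) - e i < \<bar>F (x i) + T i * G (x i)\<bar>"
      by metis
    have "\<exists>f\<in>Lp_unit_ball M p. N (- T i) - e i < \<bar>F f + (- T i) * G f\<bar>" for i by (rule maximiser[OF e])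
    then obtain y where y: "\<And>i. y i \<in> Lp_unit_ball M p" "\<And>i. N (- T i) - e i < \<bar>F (y i) + (- T i) * G (y i)\<bar>"
      by metis
    define approx where "approx f r \<longleftrightarrow> (\<forall>j. simple_function M (r j)) \<and>
        (\<lambda>j. Lp_norm M p (\<lambda>\<omega>. r j \<omega> - f \<omega>)) \<longlonglongrightarrow> 0 \<and>
        (\<lambda>j. \<integral>\<omega>. norm (r j \<omega>) powr p \<partial>M) \<longlonglongrightarrow> (\<integral>\<omega>. norm (f \<omega>) powr p \<partial>M)"
      for f :: "'a \<Rightarrow> 'x" and r
    have approx: "\<exists>r. approx f r" if "f \<in> Lp_unit_ball M p" for f
      using F.simple_approximation[of f] that unfolding approx_def Lp_unit_ball_def by blast
    obtain xs where xs: "\<And>i. approx (x i) (xs i)" using approx[OF x(1)] by metis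
    obtain ys where ys: "\<And>i. approx (y i) (ys i)" using approx[OF y(1)] by metis
    \<comment> \<open>All values of all approximants are collected, for every \<open>i\<close> and
      both signs, so that one subgroup and one family of densities serve the whole sequence.
      Dominated convergence needs the integrands for different \<open>i\<close> to come from the
      same family.\<close>
    define V where "V = (\<Union>i. \<Union>j. xs i j ` space M \<union> ys i j ` space M)"
    have "finite (xs i j ` space M)" "finite (ys i j ` space M)" for i j
      using xs[of i] ys[of i] by (auto simp: approx_def intro: simple_functionD(1))
    then have "countable V" by (simp add: V_def countable_finite)
    then obtain s :: "nat \<Rightarrow> 'x" where s: "V \<subseteq> range s" "0 \<in> range s"
      "\<And>x y. x \<in> range s \<Longrightarrow> y \<in> range s \<Longrightarrow> x - y \<in> range s"
      using countable_subset_subgroup[of V] by blast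
    obtain g where g: "\<And>v. v \<in> range s \<Longrightarrow> F.has_density v (g v)"
      "\<And>\<omega> x y. x \<in> range s \<Longrightarrow> y \<in> range s \<Longrightarrow> g (x - y) \<omega> = g x \<omega> - g y \<omega>"
      "\<And>\<omega>. bdd_above (range (\<lambda>i. \<bar>g (s i) \<omega>\<bar> / norm (s i)))"
    proof (rule F.regular_densities[OF s(3)], goal_cases)
      case (3 g)
      show ?case by (rule 3(1); fact 3)
    qed
    obtain h where h: "\<And>v. v \<in> range s \<Longrightarrow> G.has_density v (h v)"
      "\<And>\<omega> x y. x \<in> range s \<Longrightarrow> y \<in> range s \<Longrightarrow> h (x - y) \<omega> = h x \<omega> - h y \<omega>"
      "\<And>\<omega>. bdd_above (range (\<lambda>i. \<bar>h (s i) \<omega>\<bar> / norm (s i)))"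
    proof (rule G.regular_densities[OF s(3)], goal_cases)
      case (3 h)
      show ?case by (rule 3(1); fact 3)
    qed
    have gh_0: "g 0 \<omega> = 0" "h 0 \<omega> = 0" for \<omega>
      using g(2)[OF s(2,2)] h(2)[OF s(2,2)] by simp_all
    \<comment> \<open>The densities of the combination are affine in \<open>t\<close>, so no new
      exceptional set arises for individual values of \<open>t\<close>.\<close>
    have dens: "N.has_density t v (\<lambda>\<omega>. g v \<omega> + t * h v \<omega>)" if "v \<in> range s" for v t
      unfolding N.has_density_def
    proof (intro conjI ballI)
      have gv: "integrable M (g v)" and hv: "integrable M (h v)"
        using g(1)[OF that] h(1)[OF that] by (auto simp: F.has_density_def G.has_density_def)
      then show "integrable M (\<lambda>\<omega>. g v \<omega> + t * h v \<omega>)" by simp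
      fix A assume A: "A \<in> sets M"
      have "set_integrable M A (g v)" "set_integrable M A (h v)"
        unfolding set_integrable_def using A gv hv by (simp_all add: integrable_mult_indicator del: real_scaleR_def)
      then show "F (\<lambda>\<omega>. indicator A \<omega> *\<^sub>R v) + t * G (\<lambda>\<omega>. indicator A \<omega> *\<^sub>R v) =
          (\<integral>\<omega>\<in>A. g v \<omega> + t * h v \<omega> \<partial>M)"
        using g(1)[OF that] h(1)[OF that] A by (simp add: F.has_density_def G.has_density_def)
    qed
    define n where "n t \<omega> = (SUP i. \<bar>g (s i) \<omega> + t * h (s i) \<omega>\<bar> / norm (s i))" for t \<omega>
    note pointwise = SUP_second_difference[where u = "\<lambda>v. g v \<omega>" and v = "\<lambda>v. h v \<omega>" for \<omega>,
        OF diff s(2,3) g(2,3) h(2,3) q, folded n_def]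
    define I where "I t = (\<integral>\<omega>. n t \<omega> powr q \<partial>M)" for t
    have n_int: "integrable M (\<lambda>\<omega>. n t \<omega> powr q)" for t
      unfolding n_def by (rule N.integral_SUP_density_le(1)[OF dens pointwise(1)]) simp
    have I_le: "I t \<le> N t powr q" for t
      unfolding I_def n_def by (rule N.integral_SUP_density_le(2)[OF dens pointwise(1)]) simp
    define a where "a = R powr (1 - q) / q"
    have a: "0 \<le> a" using q by (simp add: a_def)
    have key: "\<bar>F f + t * G f\<bar> \<le> a * I t + R / p"
      if f: "f \<in> Lp_unit_ball M p" and r: "approx f r" "\<And>j. r j ` space M \<subseteq> range s" for f r t
      unfolding a_def I_def n_def
      using r by (intro N.abs_le_if_approximable[OF dens _ pointwise(1) R f, where y = r])
        (simp_all add: gh_0 approx_def)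
    have "xs i j ` space M \<subseteq> range s" "ys i j ` space M \<subseteq> range s" for i j
      using s(1) unfolding V_def by blast+
    note N_le = key[OF x(1) xs this(1)] key[OF y(1) ys this(2)]
    \<comment> \<open>The line with slope \<open>a\<close> and intercept \<open>R / p\<close> passes
      through the point with abscissa \<open>R powr q\<close> and ordinate \<open>R\<close>.\<close>
    have "R - R / p = a * R powr q"
    proof -
      have "R * (1 / p + 1 / q) = R" by (simp add: F.pq)
      moreover have "a * R powr q = R / q"
        using R by (simp add: a_def powr_add[symmetric])
      ultimately show ?thesis by (simp add: algebra_simps)
    qed
    moreover have "a * I 0 \<le> a * R powr q" using I_le[of 0] a by (intro mult_left_mono) (simp_all add: R_def)
    ultimately have R_ge: "a * I 0 \<le> R - R / p" by simp
    \<comment> \<open>The two upper bounds contribute \<open>R / p\<close> each, and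
      \<open>R_ge\<close> removes both again, so only second differences of \<open>I\<close> remain
      besides the error.\<close>
    have "N (T i) + N (- T i) - 2 * N 0 \<le> 2 * e i + a * (I (T i) + I (- T i) - 2 * I 0)" for i
      using x(2)[of i] y(2)[of i] N_le(1)[of i "T i"] N_le(2)[of i "- T i"] R_ge
      by (simp add: R_def algebra_simps)
    then have "(N (T i) + N (- T i) - 2 * N 0) / T i \<le>
        (2 * e i + a * (I (T i) + I (- T i) - 2 * I 0)) / T i" for i
      using T(1)[of i] by (intro divide_right_mono) simp_all
    moreover have "(2 * e i + a * (I (T i) + I (- T i) - 2 * I 0)) / T i =
        2 / real (Suc i) + a * ((I (T i) + I (- T i) - 2 * I 0) / T i)" for i
      using T(1)[of i] by (simp add: e_def add_divide_distrib del: of_nat_Suc)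
    ultimately have upper: "(N (T i) + N (- T i) - 2 * N 0) / T i \<le>
        2 / real (Suc i) + a * ((I (T i) + I (- T i) - 2 * I 0) / T i)" for i
      by metis
    have "(\<lambda>i. \<integral>\<omega>. (n (T i) \<omega> powr q + n (- T i) \<omega> powr q - 2 * n 0 \<omega> powr q) / T i \<partial>M)
        \<longlonglongrightarrow> (\<integral>\<omega>. 0 \<partial>M)"
    proof (rule integral_dominated_convergence)
      show "integrable M (\<lambda>\<omega>. n 1 \<omega> powr q + n (-1) \<omega> powr q)" using n_int by simp
      show "AE \<omega> in M. (\<lambda>i. (n (T i) \<omega> powr q + n (- T i) \<omega> powr q - 2 * n 0 \<omega> powr q) / T i) \<longlonglongrightarrow> 0"
      proof (rule AE_I2)
        fix \<omega>
        have "filterlim T (at_right 0) sequentially"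
          unfolding filterlim_at using T(1) T_lim by (simp add: less_imp_neq[symmetric])
        from filterlim_compose[OF pointwise(3) this]
        show "(\<lambda>i. (n (T i) \<omega> powr q + n (- T i) \<omega> powr q - 2 * n 0 \<omega> powr q) / T i) \<longlonglongrightarrow> 0" .
      qed
      show "AE \<omega> in M. norm ((n (T i) \<omega> powr q + n (- T i) \<omega> powr q - 2 * n 0 \<omega> powr q) / T i)
          \<le> n 1 \<omega> powr q + n (-1) \<omega> powr q" for i
      proof (rule AE_I2)
        fix \<omega>
        let ?Q = "(n (T i) \<omega> powr q + n (- T i) \<omega> powr q - 2 * n 0 \<omega> powr q) / T i"
        have "0 \<le> ?Q"
          by (rule divide_nonneg_pos[OF convex_on_second_difference_nonneg[OF pointwise(2)] T(1)])
        then have "norm ?Q = ?Q" by (simp only: real_norm_def abs_of_nonneg)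
        also have "\<dots> \<le> n 1 \<omega> powr q + n (-1) \<omega> powr q - 2 * n 0 \<omega> powr q"
          by (rule convex_on_second_difference_le[OF pointwise(2) T])
        also have "\<dots> \<le> n 1 \<omega> powr q + n (-1) \<omega> powr q" by simp
        finally show "norm ?Q \<le> n 1 \<omega> powr q + n (-1) \<omega> powr q" .
      qed
    qed (use borel_measurable_integrable[OF n_int] in measurable)
    also have "(\<lambda>i. \<integral>\<omega>. (n (T i) \<omega> powr q + n (- T i) \<omega> powr q - 2 * n 0 \<omega> powr q) / T i \<partial>M) =
        (\<lambda>i. (I (T i) + I (- T i) - 2 * I 0) / T i)"
      using n_int by (simp add: I_def)
    finally have "(\<lambda>i. 2 * inverse (real (Suc i)) + a * ((I (T i) + I (- T i) - 2 * I 0) / T i)) \<longlonglongrightarrow> 2 * 0 + a * 0"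
      by (intro tendsto_intros LIMSEQ_inverse_real_of_nat) simp
    then have lim: "(\<lambda>i. 2 / real (Suc i) + a * ((I (T i) + I (- T i) - 2 * I 0) / T i)) \<longlonglongrightarrow> 0"
      by (simp add: divide_inverse)
    have lower: "0 \<le> (N (T i) + N (- T i) - 2 * N 0) / T i" for i
      using convex_on_second_difference_nonneg[OF N_convex, of "T i"] T(1)[of i] by simp
    show "(\<lambda>i. (N (T i) + N (- T i) - 2 * N 0) / T i) \<longlonglongrightarrow> 0"
      by (rule tendsto_sandwich[OF always_eventually[OF allI[OF lower]]
            always_eventually[OF allI[OF upper]] tendsto_const lim])
  qed
qed

section \<open>From functions to classes, real scalars\<close>

lemma gateaux_differentiable_dual_Lp_space_real:
  fixes M :: "'a measure"
  assumes "prob_space M" and p: "1 < p"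
    and diff: "gateaux_differentiable (dual_space (type_space (scaleR :: real \<Rightarrow> 'x::real_normed_vector \<Rightarrow> 'x)))"
  shows "gateaux_differentiable (dual_space (Lp_space (scaleR :: real \<Rightarrow> 'x \<Rightarrow> 'x) M p))"
proof -
  interpret prob_space M by fact
  define q where "q = p / (p - 1)"
  have pq: "1 / p + 1 / q = 1" using p by (simp add: q_def field_simps)
  let ?Y = "Lp_space (scaleR :: real \<Rightarrow> 'x \<Rightarrow> 'x) M p"
  define cls where "cls f = Lp_eq M p `` {f}" for f :: "'a \<Rightarrow> 'x"
  have carrier: "vcarrier ?Y = cls ` Lp_fun M p"
    by (auto simp: Lp_space_def quotient_def cls_def)
  have functional: "\<exists>C. Lp_functional M p q C (\<lambda>f. \<phi> (cls f))" if \<phi>: "bounded_functional ?Y \<phi>" for \<phi>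
  proof -
    obtain C where C: "\<And>x. x \<in> vcarrier ?Y \<Longrightarrow> norm (\<phi> x) \<le> C * vnorm ?Y x"
      using \<phi> unfolding bounded_functional_def by blast
    have "Lp_functional M p q \<bar>C\<bar> (\<lambda>f. \<phi> (cls f))"
    proof
      fix f :: "'a \<Rightarrow> 'x" assume f: "f \<in> Lp_fun M p"
      have f': "cls f \<in> vcarrier ?Y" using f by (simp add: carrier)
      show "\<phi> (cls (\<lambda>\<omega>. f \<omega> + g \<omega>)) = \<phi> (cls f) + \<phi> (cls g)" if "g \<in> Lp_fun M p" for g
      proof -
        have "cls (\<lambda>\<omega>. f \<omega> + g \<omega>) = vadd ?Y (cls f) (cls g)"
          unfolding cls_def using p f that by (subst Lp_space_add_class) auto
        then show ?thesis using \<phi> f that by (simp add: bounded_functional_def carrier)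
      qed
      show "\<phi> (cls (\<lambda>\<omega>. r *\<^sub>R f \<omega>)) = r * \<phi> (cls f)" for r
      proof -
        have "cls (\<lambda>\<omega>. r *\<^sub>R f \<omega>) = vscale ?Y r (cls f)"
          unfolding cls_def using f by (subst Lp_space_scale_class[OF normed_scaling_scaleR]) auto
        then show ?thesis using \<phi> f' by (simp add: bounded_functional_def)
      qed
      have "\<bar>\<phi> (cls f)\<bar> \<le> C * Lp_norm M p f"
        using C[OF f'] Lp_space_norm_class[OF f, of scaleR] by (simp add: cls_def)
      also have "\<dots> \<le> \<bar>C\<bar> * Lp_norm M p f" by (intro mult_right_mono Lp_norm_nonneg) simp
      finally show "\<bar>\<phi> (cls f)\<bar> \<le> \<bar>C\<bar> * Lp_norm M p f" .
    qed (use p pq in auto)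
    then show ?thesis by blast
  qed
  have norm: "vnorm (dual_space ?Y) \<phi> = (SUP f\<in>Lp_unit_ball M p. \<bar>\<phi> (cls f)\<bar>)" for \<phi>
  proof -
    have "{x \<in> vcarrier ?Y. vnorm ?Y x \<le> 1} = cls ` Lp_unit_ball M p"
      by (auto simp: carrier Lp_unit_ball_def cls_def Lp_space_norm_class)
    then show ?thesis by (simp add: dual_space_def image_image)
  qed
  show ?thesis
    unfolding gateaux_differentiable_def
  proof (intro ballI)
    fix \<phi> \<psi> assume "\<phi> \<in> vcarrier (dual_space ?Y) - {vzero (dual_space ?Y)}" "\<psi> \<in> vcarrier (dual_space ?Y)"
    then have \<phi>: "bounded_functional ?Y \<phi>" "\<phi> \<noteq> vzero (dual_space ?Y)" and \<psi>: "bounded_functional ?Y \<psi>"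
      by (simp_all add: dual_space_def)
    define F where "F f = \<phi> (cls f)" for f
    define G where "G f = \<psi> (cls f)" for f
    obtain C D where F: "Lp_functional M p q C F" and G: "Lp_functional M p q D G"
      using functional[OF \<phi>(1)] functional[OF \<psi>] unfolding F_def G_def by blast
    define N where "N t = (SUP f\<in>Lp_unit_ball M p. \<bar>F f + t * G f\<bar>)" for t
    have "N t = vnorm (dual_space ?Y) (vadd (dual_space ?Y) \<phi> (vscale (dual_space ?Y) (of_real t) \<psi>))" for t
      unfolding norm N_def F_def G_def
      by (intro SUP_cong refl) (auto simp: dual_space_def carrier Lp_unit_ball_def)
    note N_eq = this[symmetric]
    have N_0: "vnorm (dual_space ?Y) \<phi> = N 0" by (simp add: norm N_def F_def)
    \<comment> \<open>Both \<open>\<phi>\<close> and the zero functional are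
      \<open>undefined\<close> outside the carrier, so they can differ only on it.\<close>
    have "\<exists>x\<in>vcarrier ?Y. \<phi> x \<noteq> 0"
    proof (rule ccontr)
      assume "\<not> ?thesis"
      then have "\<phi> = (\<lambda>x\<in>vcarrier ?Y. 0)"
        using \<phi>(1) by (intro extensionalityI[of _ "vcarrier ?Y"]) (auto simp: bounded_functional_def)
      then show False using \<phi>(2) by (simp add: dual_space_def)
    qed
    then obtain f where f: "f \<in> Lp_fun M p" "F f \<noteq> 0" by (auto simp: carrier F_def)
    interpret Lp_functional M p q "N 0" F
      using Lp_functional.Lp_functional_SUP[OF F] by (simp add: N_def)
    have "0 < \<bar>F f\<bar>" using f(2) by simp
    also have "\<dots> \<le> N 0 * Lp_norm M p f" by (rule bound[OF f(1)])
    finally have "0 < N 0" using C_nonneg by (auto simp: zero_less_mult_iff)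
    then have "\<exists>l. ((\<lambda>t. (N t - N 0) / t) \<longlongrightarrow> l) (at 0)"
      unfolding N_def by (intro convex_on_differentiable_at_0 Lp_norm_second_difference[OF diff F G])
    then show "\<exists>l. ((\<lambda>t::real. (vnorm (dual_space ?Y) (vadd (dual_space ?Y) \<phi>
        (vscale (dual_space ?Y) (of_real t) \<psi>)) - vnorm (dual_space ?Y) \<phi>) / t) \<longlongrightarrow> l) (at 0)"
      unfolding N_eq N_0 .
  qed
qed

section \<open>Complex scalars\<close>

text \<open>The reduction is needed for X and for L^p(X), in opposite directions, hence an abstract
  pair of a complex space and its real restriction.\<close>

locale underlying_real_space =
  fixes Y :: "(complex, 'v) nspace" and Z :: "(real, 'v) nspace"
  assumes carrier_eq: "vcarrier Z = vcarrier Y"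
    and add_eq: "vadd Z = vadd Y"
    and norm_eq: "vnorm Z = vnorm Y"
    and scale_eq: "\<And>r x. x \<in> vcarrier Y \<Longrightarrow> vscale Z r x = vscale Y (of_real r) x"
    and scale_closed: "\<And>c x. x \<in> vcarrier Y \<Longrightarrow> vscale Y c x \<in> vcarrier Y"
    and add_closed: "\<And>x y. x \<in> vcarrier Y \<Longrightarrow> y \<in> vcarrier Y \<Longrightarrow> vadd Y x y \<in> vcarrier Y"
    and norm_nonneg: "\<And>x. x \<in> vcarrier Y \<Longrightarrow> 0 \<le> vnorm Y x"
    and norm_unimodular: "\<And>c x. x \<in> vcarrier Y \<Longrightarrow> norm c = 1 \<Longrightarrow> vnorm Y (vscale Y c x) = vnorm Y x"
begin

definition re_part :: "('v \<Rightarrow> complex) \<Rightarrow> 'v \<Rightarrow> real" where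
  "re_part \<phi> = (\<lambda>x\<in>vcarrier Y. Re (\<phi> x))"

lemma bounded_functional_re_part:
  assumes "bounded_functional Y \<phi>"
  shows "bounded_functional Z (re_part \<phi>)"
proof -
  obtain C where C: "\<And>x. x \<in> vcarrier Y \<Longrightarrow> norm (\<phi> x) \<le> C * vnorm Y x"
    using assms unfolding bounded_functional_def by blast
  have "\<bar>Re (\<phi> x)\<bar> \<le> C * vnorm Y x" if "x \<in> vcarrier Y" for x
    using C[OF that] abs_Re_le_cmod[of "\<phi> x"] by linarith
  then show ?thesis
    using assms unfolding bounded_functional_def re_part_def
    by (auto simp: carrier_eq add_eq norm_eq scale_eq scale_closed add_closed)
qed

text \<open>A unimodular scalar rotates the value at a vector to a nonnegative real without moving
  the vector out of the unit ball.\<close>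

lemma dual_norm_re_part:
  assumes \<phi>: "bounded_functional Y \<phi>"
  shows "vnorm (dual_space Z) (re_part \<phi>) = vnorm (dual_space Y) \<phi>"
proof -
  define B where "B = {x \<in> vcarrier Y. vnorm Y x \<le> 1}"
  have Z: "vnorm (dual_space Z) (re_part \<phi>) = (SUP x\<in>B. \<bar>Re (\<phi> x)\<bar>)"
    unfolding dual_space_def by (auto simp: B_def carrier_eq norm_eq re_part_def intro!: SUP_cong)
  have Y: "vnorm (dual_space Y) \<phi> = (SUP x\<in>B. norm (\<phi> x))"
    by (simp add: dual_space_def B_def)
  obtain C where C: "\<And>x. x \<in> vcarrier Y \<Longrightarrow> norm (\<phi> x) \<le> C * vnorm Y x"
    using \<phi> unfolding bounded_functional_def by blast
  have bound: "norm (\<phi> x) \<le> \<bar>C\<bar>" if "x \<in> B" for x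
  proof -
    have "C * vnorm Y x \<le> \<bar>C\<bar> * 1"
      using that norm_nonneg[of x] by (intro mult_mono) (auto simp: B_def)
    then show ?thesis using C[of x] that by (simp add: B_def)
  qed
  have bdd: "bdd_above ((\<lambda>x. norm (\<phi> x)) ` B)" "bdd_above ((\<lambda>x. \<bar>Re (\<phi> x)\<bar>) ` B)"
    using bound order_trans[OF abs_Re_le_cmod bound] by (auto intro!: bdd_aboveI2)
  show ?thesis
  \<comment> \<open>The locale does not ask for a zero vector, so the unit ball may be empty; both
    sides are then the supremum of the empty set.\<close>
  proof (cases "B = {}")
    case True
    then show ?thesis by (simp add: Z Y)
  next
    case False
    have "(SUP x\<in>B. \<bar>Re (\<phi> x)\<bar>) \<le> (SUP x\<in>B. norm (\<phi> x))"
      using False by (intro cSUP_mono bdd) (auto intro: abs_Re_le_cmod)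
    moreover have "(SUP x\<in>B. norm (\<phi> x)) \<le> (SUP x\<in>B. \<bar>Re (\<phi> x)\<bar>)"
    proof (rule cSUP_mono[OF False bdd(2)])
      fix x assume x: "x \<in> B"
      define c where "c = (if \<phi> x = 0 then 1 else cnj (sgn (\<phi> x)))"
      have c: "norm c = 1" "c * \<phi> x = of_real (norm (\<phi> x))"
        by (auto simp: c_def norm_sgn norm_divide sgn_eq complex_norm_square[symmetric] power2_eq_square
            mult.commute[of "cnj _"])
      have "\<phi> (vscale Y c x) = c * \<phi> x"
        using \<phi> x unfolding bounded_functional_def B_def by blast
      then have "norm (\<phi> x) \<le> \<bar>Re (\<phi> (vscale Y c x))\<bar>" by (simp add: c(2))
      moreover have "vscale Y c x \<in> B"
        using x c(1) by (simp add: B_def scale_closed norm_unimodular)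
      ultimately show "\<exists>y\<in>B. norm (\<phi> x) \<le> \<bar>Re (\<phi> y)\<bar>" by blast
    qed
    ultimately show ?thesis by (simp add: Z Y)
  qed
qed

text \<open>The imaginary part is determined by the real part, as
  \<open>Im (\<phi> x) = - Re (\<phi> (vscale Y \<i> x))\<close>.\<close>

lemma re_part_eq_iff:
  assumes "bounded_functional Y \<phi>" "bounded_functional Y \<psi>"
  shows "re_part \<phi> = re_part \<psi> \<longleftrightarrow> \<phi> = \<psi>"
proof
  assume eq: "re_part \<phi> = re_part \<psi>"
  have Re: "Re (\<phi> x) = Re (\<psi> x)" if "x \<in> vcarrier Y" for x
    using fun_cong[OF eq, of x] that by (simp add: re_part_def)
  show "\<phi> = \<psi>"
  proof (rule extensionalityI)
    show "\<phi> \<in> extensional (vcarrier Y)" "\<psi> \<in> extensional (vcarrier Y)"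
      using assms by (simp_all add: bounded_functional_def)
    fix x assume x: "x \<in> vcarrier Y"
    have "\<phi> (vscale Y \<i> x) = \<i> * \<phi> x" "\<psi> (vscale Y \<i> x) = \<i> * \<psi> x"
      using assms x unfolding bounded_functional_def by blast+
    with Re[OF scale_closed[OF x, of \<i>]] Re[OF x] show "\<phi> x = \<psi> x"
      by (simp add: complex_eq_iff)
  qed
qed simp

lemma bounded_functional_combination:
  assumes "bounded_functional Y \<phi>" "bounded_functional Y \<psi>"
  shows "bounded_functional Y (vadd (dual_space Y) \<phi> (vscale (dual_space Y) c \<psi>))"
proof -
  obtain C D where C: "\<And>x. x \<in> vcarrier Y \<Longrightarrow> norm (\<phi> x) \<le> C * vnorm Y x"
    and D: "\<And>x. x \<in> vcarrier Y \<Longrightarrow> norm (\<psi> x) \<le> D * vnorm Y x"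
    using assms unfolding bounded_functional_def by metis
  have "norm (\<phi> x + c * \<psi> x) \<le> (C + norm c * D) * vnorm Y x" if "x \<in> vcarrier Y" for x
    using norm_triangle_ineq[of "\<phi> x" "c * \<psi> x"] C[OF that]
      mult_left_mono[OF D[OF that], of "norm c"] by (simp add: norm_mult algebra_simps)
  then have "\<exists>K. \<forall>x\<in>vcarrier Y. norm (\<phi> x + c * \<psi> x) \<le> K * vnorm Y x" by blast
  then show ?thesis
    using assms unfolding bounded_functional_def dual_space_def
    by (intro conjI) (auto simp: scale_closed add_closed algebra_simps)
qed

lemma re_part_combination:
  "re_part (vadd (dual_space Y) \<phi> (vscale (dual_space Y) (of_real t) \<psi>)) =
   vadd (dual_space Z) (re_part \<phi>) (vscale (dual_space Z) t (re_part \<psi>))"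
  by (auto simp: dual_space_def re_part_def carrier_eq fun_eq_iff)

lemma re_part_zero: "re_part (vzero (dual_space Y)) = vzero (dual_space Z)"
  by (auto simp: dual_space_def re_part_def carrier_eq fun_eq_iff)

lemma bounded_functional_zero: "bounded_functional Y (vzero (dual_space Y))"
  by (auto simp: dual_space_def bounded_functional_def scale_closed add_closed intro: exI[of _ 0])

text \<open>\<open>re_part\<close> is an injective real-linear isometry of the dual spaces, and the
  difference quotients involve real \<open>t\<close> only. This direction serves the conclusion
  about L^p(X).\<close>

lemma gateaux_differentiable_dual_if_real:
  assumes "gateaux_differentiable (dual_space Z)"
  shows "gateaux_differentiable (dual_space Y)"
  unfolding gateaux_differentiable_def
proof (intro ballI)
  fix \<phi> \<psi> assume "\<phi> \<in> vcarrier (dual_space Y) - {vzero (dual_space Y)}" "\<psi> \<in> vcarrier (dual_space Y)"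
  then have \<phi>: "bounded_functional Y \<phi>" "\<phi> \<noteq> vzero (dual_space Y)" and \<psi>: "bounded_functional Y \<psi>"
    by (simp_all add: dual_space_def)
  have "re_part \<phi> \<in> vcarrier (dual_space Z) - {vzero (dual_space Z)}"
    "re_part \<psi> \<in> vcarrier (dual_space Z)"
    using bounded_functional_re_part[OF \<phi>(1)] bounded_functional_re_part[OF \<psi>] \<phi>(2)
      re_part_eq_iff[OF \<phi>(1) bounded_functional_zero]
    by (simp_all add: dual_space_def[of Z] re_part_zero[symmetric, unfolded dual_space_def[of Z], simplified])
  with assms obtain l where "((\<lambda>t. (vnorm (dual_space Z) (vadd (dual_space Z) (re_part \<phi>)
      (vscale (dual_space Z) (of_real t) (re_part \<psi>))) - vnorm (dual_space Z) (re_part \<phi>)) / t) \<longlongrightarrow> l) (at 0)"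
    unfolding gateaux_differentiable_def by blast
  then show "\<exists>l. ((\<lambda>t::real. (vnorm (dual_space Y) (vadd (dual_space Y) \<phi>
      (vscale (dual_space Y) (of_real t) \<psi>)) - vnorm (dual_space Y) \<phi>) / t) \<longlongrightarrow> l) (at 0)"
    by (simp add: re_part_combination[symmetric] dual_norm_re_part \<phi> \<psi> bounded_functional_combination)
       blast
qed

text \<open>Here points and directions are given in the dual of \<open>Z\<close> and must be lifted
  to that of \<open>Y\<close>, hence surjectivity of \<open>re_part\<close>. This direction serves
  the assumption on X.\<close>

lemma gateaux_differentiable_dual_real_if_surj:
  assumes diff: "gateaux_differentiable (dual_space Y)"
    and surj: "\<And>u. bounded_functional Z u \<Longrightarrow> \<exists>\<phi>. bounded_functional Y \<phi> \<and> re_part \<phi> = u"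
  shows "gateaux_differentiable (dual_space Z)"
  unfolding gateaux_differentiable_def
proof (intro ballI)
  fix u v assume "u \<in> vcarrier (dual_space Z) - {vzero (dual_space Z)}" "v \<in> vcarrier (dual_space Z)"
  then have u: "bounded_functional Z u" "u \<noteq> vzero (dual_space Z)" and v: "bounded_functional Z v"
    by (simp_all add: dual_space_def)
  obtain \<phi> \<psi> where \<phi>: "bounded_functional Y \<phi>" "re_part \<phi> = u" and \<psi>: "bounded_functional Y \<psi>" "re_part \<psi> = v"
    using surj u(1) v by metis
  have "\<phi> \<in> vcarrier (dual_space Y) - {vzero (dual_space Y)}" "\<psi> \<in> vcarrier (dual_space Y)"
    using \<phi> \<psi> u(2) re_part_zero by (auto simp: dual_space_def[of Y])
  with diff obtain l where "((\<lambda>t::real. (vnorm (dual_space Y) (vadd (dual_space Y) \<phi>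
      (vscale (dual_space Y) (of_real t) \<psi>)) - vnorm (dual_space Y) \<phi>) / t) \<longlongrightarrow> l) (at 0)"
    unfolding gateaux_differentiable_def by blast
  then have "((\<lambda>t. (vnorm (dual_space Z) (vadd (dual_space Z) u
      (vscale (dual_space Z) t v)) - vnorm (dual_space Z) u) / t) \<longlongrightarrow> l) (at 0)"
    using \<phi> \<psi> by (simp add: re_part_combination dual_norm_re_part[symmetric] bounded_functional_combination)
  then show "\<exists>l. ((\<lambda>t. (vnorm (dual_space Z) (vadd (dual_space Z) u
      (vscale (dual_space Z) (of_real t) v)) - vnorm (dual_space Z) u) / t) \<longlongrightarrow> l) (at 0)"
    by auto
qed

end

lemma gateaux_differentiable_dual_type_space_real:
  fixes s :: "complex \<Rightarrow> 'x::real_normed_vector \<Rightarrow> 'x"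
  assumes s: "normed_scaling s" and diff: "gateaux_differentiable (dual_space (type_space s))"
  shows "gateaux_differentiable (dual_space (type_space (scaleR :: real \<Rightarrow> 'x \<Rightarrow> 'x)))"
proof -
  have vs: "vector_space s" and s_real: "\<And>r x. s (of_real r) x = r *\<^sub>R x"
    and s_norm: "\<And>c x. norm (s c x) = norm c * norm x"
    using s unfolding normed_scaling_def by auto
  interpret underlying_real_space "type_space s" "type_space (scaleR :: real \<Rightarrow> 'x \<Rightarrow> 'x)"
    by unfold_locales (simp_all add: type_space_def s_real s_norm)
  show ?thesis
  proof (rule gateaux_differentiable_dual_real_if_surj[OF diff])
    fix u :: "'x \<Rightarrow> real" assume u: "bounded_functional (type_space scaleR) u"
    then have u_add: "\<And>x y. u (x + y) = u x + u y" and u_scale: "\<And>r x. u (r *\<^sub>R x) = r * u x"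
      unfolding bounded_functional_def by (simp_all add: type_space_def)
    obtain C where C: "\<And>x. \<bar>u x\<bar> \<le> C * norm x"
      using u unfolding bounded_functional_def by (auto simp: type_space_def)
    \<comment> \<open>The complex functional with real part \<open>u\<close>; complex linearity
      forces its imaginary part.\<close>
    define \<phi> where "\<phi> x = Complex (u x) (- u (s \<i> x))" for x
    have s_eq: "s c x = Re c *\<^sub>R x + Im c *\<^sub>R s \<i> x" for c x
    proof -
      have "s c x = s (of_real (Re c) + of_real (Im c) * \<i>) x"
        by (simp only: complex_eq[of c, symmetric] mult.commute[of "of_real (Im c)" \<i>])
      also have "\<dots> = s (of_real (Re c)) x + s (of_real (Im c)) (s \<i> x)"
        using vs by (simp add: vector_space_def)
      finally show ?thesis by (simp only: s_real)
    qed
    have s_ii: "s \<i> (s \<i> x) = - x" for x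
      using vs s_real[of "-1" x] by (simp add: vector_space_def)
    have s_i: "s \<i> (x + y) = s \<i> x + s \<i> y" "s \<i> (r *\<^sub>R x) = r *\<^sub>R s \<i> x" for x y r
      using vs by (simp_all add: vector_space_def s_real[symmetric] mult.commute)
    have u_diff: "u (x - y) = u x - u y" for x y using u_add[of x "-1 *\<^sub>R y"] u_scale[of "-1" y] by simp
    \<comment> \<open>A crude constant is enough for boundedness; equality of the norms comes from
      \<open>dual_norm_re_part\<close>.\<close>
    have "norm (\<phi> x) \<le> 2 * C * norm x" for x
      using cmod_le[of "\<phi> x"] C[of x] C[of "s \<i> x"] by (simp add: \<phi>_def s_norm)
    moreover have "\<phi> (x + y) = \<phi> x + \<phi> y" for x y
      by (simp add: \<phi>_def u_add s_i complex_eq_iff)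
    moreover have "\<phi> (s c x) = c * \<phi> x" for c x
    proof -
      have "u (s c x) = Re c * u x + Im c * u (s \<i> x)"
        by (subst s_eq) (simp add: u_add u_scale)
      moreover have "u (s \<i> (s c x)) = Re c * u (s \<i> x) - Im c * u x"
        by (subst s_eq[of c]) (simp add: u_add u_diff u_scale s_i s_ii)
      ultimately show ?thesis by (simp add: \<phi>_def complex_eq_iff)
    qed
    ultimately have "bounded_functional (type_space s) \<phi>"
      unfolding bounded_functional_def type_space_def by auto
    moreover have "re_part \<phi> = u"
      unfolding re_part_def by (simp add: type_space_def \<phi>_def fun_eq_iff)
    ultimately show "\<exists>\<phi>. bounded_functional (type_space s) \<phi> \<and> re_part \<phi> = u" by blast
  qed
qed

text \<open>Carrier, addition and norm of the Bochner space do not involve the scalars, so the real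
  and complex versions differ only in multiplication, which is compared on representatives.\<close>

lemma gateaux_differentiable_dual_Lp_space_complex:
  fixes s :: "complex \<Rightarrow> 'x::real_normed_vector \<Rightarrow> 'x"
  assumes s: "normed_scaling s" and p: "0 \<le> p"
    and diff: "gateaux_differentiable (dual_space (Lp_space (scaleR :: real \<Rightarrow> 'x \<Rightarrow> 'x) M p))"
  shows "gateaux_differentiable (dual_space (Lp_space s M p))"
proof -
  have carrier: "x \<in> vcarrier (Lp_space s M p) \<longleftrightarrow> (\<exists>f\<in>Lp_fun M p. x = Lp_eq M p `` {f})" for x
    unfolding Lp_space_def quotient_def by auto
  have s_real: "\<And>r x. s (of_real r) x = r *\<^sub>R x"
    and s_norm: "\<And>c x. norm (s c x) = norm c * norm x"
    using s unfolding normed_scaling_def by auto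
  interpret underlying_real_space "Lp_space s M p" "Lp_space (scaleR :: real \<Rightarrow> 'x \<Rightarrow> 'x) M p"
  proof
    show "vscale (Lp_space scaleR M p) r x = vscale (Lp_space s M p) (of_real r) x"
      "vscale (Lp_space s M p) c x \<in> vcarrier (Lp_space s M p)"
      "0 \<le> vnorm (Lp_space s M p) x"
      "norm c = 1 \<Longrightarrow> vnorm (Lp_space s M p) (vscale (Lp_space s M p) c x) = vnorm (Lp_space s M p) x"
      if "x \<in> vcarrier (Lp_space s M p)" for r c x
    proof -
      from that obtain f where f: "f \<in> Lp_fun M p" "x = Lp_eq M p `` {f}" unfolding carrier by blast
      show "vscale (Lp_space scaleR M p) r x = vscale (Lp_space s M p) (of_real r) x"
        by (simp add: f Lp_space_scale_class[OF s] Lp_space_scale_class[OF normed_scaling_scaleR] s_real)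
      show "vscale (Lp_space s M p) c x \<in> vcarrier (Lp_space s M p)"
        unfolding carrier using f Lp_fun_scale[OF s f(1)] by (auto simp: Lp_space_scale_class[OF s])
      show "0 \<le> vnorm (Lp_space s M p) x"
        by (simp add: f Lp_space_norm_class Lp_norm_def)
      show "vnorm (Lp_space s M p) (vscale (Lp_space s M p) c x) = vnorm (Lp_space s M p) x" if "norm c = 1"
        using that by (simp add: f Lp_space_scale_class[OF s] Lp_space_norm_class Lp_fun_scale[OF s] Lp_norm_def s_norm)
    qed
    show "vadd (Lp_space s M p) x y \<in> vcarrier (Lp_space s M p)"
      if "x \<in> vcarrier (Lp_space s M p)" "y \<in> vcarrier (Lp_space s M p)" for x y
      using that unfolding carrier
      by (auto simp: Lp_space_add_class[OF p] intro!: Lp_fun_add[OF p] bexI)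
  qed (simp_all add: Lp_space_def)
  show ?thesis by (rule gateaux_differentiable_dual_if_real[OF diff])
qed

theorem mainTheorem3:
  fixes M :: "'a measure" and p :: real
    and scaleC :: "complex \<Rightarrow> 'x::banach \<Rightarrow> 'x"
  assumes "prob_space M" and "1 < p"
  shows "(gateaux_differentiable (dual_space (type_space (scaleR :: real \<Rightarrow> 'x \<Rightarrow> 'x))) \<longrightarrow>
          gateaux_differentiable (dual_space (Lp_space (scaleR :: real \<Rightarrow> 'x \<Rightarrow> 'x) M p))) \<and>
         (normed_scaling scaleC \<longrightarrow>
          gateaux_differentiable (dual_space (type_space scaleC)) \<longrightarrow>
          gateaux_differentiable (dual_space (Lp_space scaleC M p)))"
proof (intro conjI impI)
  assume "gateaux_differentiable (dual_space (type_space (scaleR :: real \<Rightarrow> 'x \<Rightarrow> 'x)))"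
  then show "gateaux_differentiable (dual_space (Lp_space (scaleR :: real \<Rightarrow> 'x \<Rightarrow> 'x) M p))"
    by (rule gateaux_differentiable_dual_Lp_space_real[OF assms])
next
  assume s: "normed_scaling scaleC" and diff: "gateaux_differentiable (dual_space (type_space scaleC))"
  \<comment> \<open>Read from the last rule upwards: restrict the scalars on X, apply the real
    result, and return to complex scalars on L^p(X).\<close>
  show "gateaux_differentiable (dual_space (Lp_space scaleC M p))"
    using assms(2)
    by (intro gateaux_differentiable_dual_Lp_space_complex[OF s]
        gateaux_differentiable_dual_Lp_space_real[OF assms]
        gateaux_differentiable_dual_type_space_real[OF s diff]) simp
qed

end
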